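(* Let $p\in[2,\infty)$, $r\in[0,1]$, $\gamma\in(0,\frac12]$. Assume: (1) $A\colon \mathrm{dom}(A)\subset H\to H$ is linear, densely defined, self-adjoint and positive definite with compact inverse; (2) $X_0\in L^p(\Omega_W,\mathcal F^W_0,\mathbb P_W;\dot H^{1+r})$; (3) $f\colon[0,T]\times H\to H$ is continuous and there is $C_f\in(0,\infty)$ with $\|f(t,u_1)-f(t,u_2)\|\le C_f\|u_1-u_2\|$ and $\|f(t_1,u)-f(t_2,u)\|\le C_f(1+\|u\|)|t_1-t_2|^\gamma$ for all $u,u_1,u_2\in H$, $t,t_1,t_2\in[0,T]$; (4) $g\colon[0,T]\to\mathcal L_2^0$ is continuous and there is $C_g\in(0,\infty)$ with $\|g\|_{C^{1/2}([0,T];\mathcal L_2^0)}+\|A^{r/2}g\|_{C([0,T];\mathcal L_2^0)}+\|g\|_{W^{1/2+\gamma,p}(0,T;\mathcal L_2^0)}\le C_g$; (5) the covariance operator $Q\in\mathcal L(U)$ of $W$ is symmetric, nonnegative and of finite trace. Then the noise-truncated randomized Galerkin finite element method is bistable with respect to the norms $\|\cdot\|_{\infty,p}$ and $\|\cdot\|_{S,p,h}$, with a stability constant that can be chosen independently of $M$: for all $k\in(0,T)$, $h\in(0,1)$, $M\in\mathbb N$ the residual operator $\mathcal R_{k,h,M}\colon\mathcal G_k^p\to\mathcal G_k^p$ is well-defined and bijective, and there exists $C_{\mathrm{Stab}}\in(0,\infty)$, independent of $k$, $h$ and $M$, such that for all $k\in(0,T)$, $h\in(0,1)$, $M\in\mathbb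 N$ and $Y_k,Z_k\in\mathcal G_k^p$ $$\frac1{C_{\mathrm{Stab}}}\big\|\mathcal R_{k,h,M}[Y_k]-\mathcal R_{k,h,M}[Z_k]\big\|_{S,p,h}\le\|Y_k-Z_k\|_{\infty,p}\le C_{\mathrm{Stab}}\big\|\mathcal R_{k,h,M}[Y_k]-\mathcal R_{k,h,M}[Z_k]\big\|_{S,p,h}.$$
   Context: Spaces and noise. $(H,(\cdot,\cdot),\|\cdot\|)$ and $(U,(\cdot,\cdot)_U,\|\cdot\|_U)$ are separable real Hilbert spaces, $T\in(0,\infty)$, $(\Omega_W,\mathcal F^W,(\mathcal F^W_t)_{t\in[0,T]},\mathbb P_W)$ is a filtered probability space satisfying the usual conditions, and $W\colon[0,T]\times\Omega_W\to U$ is a $Q$-Wiener process with respect to $(\mathcal F_t^W)$. $\mathcal L_2^0=\mathcal L_2(Q^{1/2}(U),H)$ is the space of Hilbert–Schmidt operators, with $\|L\|_{\mathcal L_2^0}=\|LQ^{1/2}\|_{\mathcal L_2(U,H)}$. Truncated noise. $(\varphi_j)_{j\in\mathbb N}$ is an orthonormal basis of $U$ with $Q\varphi_j=\mu_j\varphi_j$. For $M\in\mathbb N$, $W^M(t)=\sum_{j=1}^M\sqrt{\mu_j}\,\beta_j(t)\varphi_j$, where $\beta_j(t)=\mu_j^{-1/2}(W(t),\varphi_j)_U$ (for $\mu_j>0$; terms with $\mu_j=0$ vanish) are independent standard real Brownian motions. $\Delta_\kappa W^M(t):=W^M(t+\kappa)-W^M(t)$. Operator $A$. $A$ has eigenvalues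 $0<\lambda_1\le\lambda_2\le\dots\to\infty$ with an orthonormal basis $(e_j)$ of eigenvectors. For $r\ge0$, $A^{r/2}x=\sum_j\lambda_j^{r/2}(x,e_j)e_j$ on $\dot H^r:=\mathrm{dom}(A^{r/2})$, with $(x,y)_r=(A^{r/2}x,A^{r/2}y)$, $\|x\|_r=\|A^{r/2}x\|$. Function norms. $C([0,T];E)$ carries the sup norm; $\|v\|_{C^\alpha([0,T];E)}=\sup_t\|v(t)\|_E+\sup_{t_1\ne t_2}\|v(t_1)-v(t_2)\|_E|t_1-t_2|^{-\alpha}$; $\|v\|_{W^{1,p}(0,T;E)}^p=\int_0^T\|v\|_E^p\,\mathrm dt+\int_0^T\|v'\|_E^p\,\mathrm dt$; for $\nu\in(0,1)$, $\|v\|_{W^{\nu,p}(0,T;E)}^p=\int_0^T\|v\|_E^p\,\mathrm dt+\int_0^T\int_0^T\frac{\|v(t_1)-v(t_2)\|_E^p}{|t_1-t_2|^{1+\nu p}}\,\mathrm dt_2\,\mathrm dt_1$. Spatial discretization. $(V_h)_{h\in(0,1)}$ is a family of finite dimensional subspaces of $\dot H^1$; $P_h\colon H\to V_h$ is the orthogonal projector in $H$; $A_h\colon V_h\to V_h$ is given by $(A_hx_h,y_h)=(x_h,y_h)_1$ for all $x_h,y_h\in V_h$; $S_{\theta,h}:=(\mathrm{Id}+\theta A_h)^{-1}P_h\in\mathcal L(H)$ for $\theta\in[0,T]$; $S_{k,h}^0=\mathrm{Id}$. $\xi_h:=P_hX_0$. Time grid and randomization. For $k\in(0,T)$: $t_n=nk$,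 $n=0,\dots,N_k$, where $N_kk\le T<(N_k+1)k$, $N_k\in\mathbb N$. $(\tau_n)_{n\in\mathbb N}$ are independent $\mathcal U(0,1)$-distributed random variables on a further probability space $(\Omega_\tau,\mathcal F^\tau,\mathbb P_\tau)$; $(\Omega,\mathcal F,\mathbb P)=(\Omega_W\times\Omega_\tau,\mathcal F^W\otimes\mathcal F^\tau,\mathbb P_W\otimes\mathbb P_\tau)$; $\mathcal F_0^\tau$ is trivial, $\mathcal F_n^\tau=\sigma\{\tau_j:1\le j\le n\}$; $\mathcal F_n^{\pi_k}=\mathcal F^W_{t_n}\otimes\mathcal F_n^\tau$. Truncated scheme. For $x\in H$, $\tau\in[0,1]$, $j\in\{1,\dots,N_k\}$: $\Psi_{k,h,M}^j(x,\tau)=S_{\tau k,h}[x-\tau kf(t_{j-1},x)+g(t_{j-1})\Delta_{\tau k}W^M(t_{j-1})]$, $\Phi_{k,h,M}^j(x,\tau)=-kS_{k,h}f(t_{j-1}+\tau k,\Psi_{k,h,M}^j(x,\tau))+S_{k,h}g(t_{j-1}+\tau k)\Delta_kW^M(t_{j-1})$. The noise-truncated scheme is $X_{k,h,M}^0=\xi_h$, $X_{k,h,M}^n=S_{k,h}X_{k,h,M}^{n-1}+\Phi_{k,h,M}^n(X_{k,h,M}^{n-1},\tau_n)$. Grid functions, norms, residuals. $\mathcal G_k^p=\{(Z_k^n)_{n\in\{0,\dots,N_k\}}:Z_k^n\in L^p(\Omega,\mathcal F_n^{\pi_k},\mathbb P;H)\text{ for all }n\}$; $\|Z_k\|_{\infty,p}=\max_{0\le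 n\le N_k}\|Z_k^n\|_{L^p(\Omega;H)}$; $\|Z_k\|_{S,p,h}=\|Z_k^0\|_{L^p(\Omega;H)}+\max_{1\le n\le N_k}\|\sum_{j=1}^nS_{k,h}^{n-j}Z_k^j\|_{L^p(\Omega;H)}$. $\mathcal R_{k,h,M}[Z_k](t_0)=Z_k^0-\xi_h$ and $\mathcal R_{k,h,M}[Z_k](t_n)=Z_k^n-S_{k,h}Z_k^{n-1}-\Phi_{k,h,M}^n(Z_k^{n-1},\tau_n)$ for $n\in\{1,\dots,N_k\}$. *)

theory Defs
  imports "HOL-Probability.Probability"
begin

section \<open>Operators on Hilbert spaces\<close>

definition orthonormal_basis :: "(nat \<Rightarrow> 'a::real_inner) \<Rightarrow> bool" where
  "orthonormal_basis e \<longleftrightarrow>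
     (\<forall>i j. e i \<bullet> e j = (if i = j then 1 else 0)) \<and> closure (span (range e)) = UNIV"

definition linear_operator :: "'a::real_vector set \<Rightarrow> ('a \<Rightarrow> 'b::real_vector) \<Rightarrow> bool" where
  "linear_operator D A \<longleftrightarrow> subspace D \<and>
     (\<forall>x\<in>D. \<forall>y\<in>D. A (x + y) = A x + A y) \<and> (\<forall>c. \<forall>x\<in>D. A (c *\<^sub>R x) = c *\<^sub>R A x)"

text \<open>For a densely defined operator, the left-hand side below is the graph of its adjoint.\<close>

definition self_adjoint_operator :: "'a::real_inner set \<Rightarrow> ('a \<Rightarrow> 'a) \<Rightarrow> bool" where
  "self_adjoint_operator D A \<longleftrightarrow>
     {(y, z). \<forall>x\<in>D. A x \<bullet> y = x \<bullet> z} = {(x, A x) | x. x \<in> D}"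

definition compact_operator :: "('a::real_normed_vector \<Rightarrow> 'b::real_normed_vector) \<Rightarrow> bool" where
  "compact_operator K \<longleftrightarrow> bounded_linear K \<and> (\<forall>S. bounded S \<longrightarrow> compact (closure (K ` S)))"

definition has_compact_inverse :: "'a::real_normed_vector set \<Rightarrow> ('a \<Rightarrow> 'a) \<Rightarrow> bool" where
  "has_compact_inverse D A \<longleftrightarrow> bij_betw A D UNIV \<and> compact_operator (the_inv_into D A)"

text \<open>
  The power \<open>B\<^sup>s\<close> of the operator \<open>B\<close> with eigenvalues \<open>lam j \<ge> 0\<close> and orthonormal basis of
  eigenvectors \<open>e j\<close>. It is used for \<open>A\<close> and, with exponent \<open>1/2\<close>, for \<open>Q\<close>. Sequences that are
  numbered from 1 in the mathematical notation (eigenvalues, bases) are numbered from 0 here.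
\<close>

definition op_pow :: "(nat \<Rightarrow> real) \<Rightarrow> (nat \<Rightarrow> 'a::real_inner) \<Rightarrow> real \<Rightarrow> 'a \<Rightarrow> 'a" where
  "op_pow lam e s x = (\<Sum>j. (lam j powr s * (x \<bullet> e j)) *\<^sub>R e j)"

definition dotH :: "(nat \<Rightarrow> real) \<Rightarrow> (nat \<Rightarrow> 'a::real_inner) \<Rightarrow> real \<Rightarrow> 'a set" where
  "dotH lam e r = {x. summable (\<lambda>j. (lam j powr (r / 2) * (x \<bullet> e j)) *\<^sub>R e j)}"

definition dotH_inner :: "(nat \<Rightarrow> real) \<Rightarrow> (nat \<Rightarrow> 'a::real_inner) \<Rightarrow> real \<Rightarrow> 'a \<Rightarrow> 'a \<Rightarrow> real" where
  "dotH_inner lam e r x y = op_pow lam e (r / 2) x \<bullet> op_pow lam e (r / 2) y"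

definition dotH_norm :: "(nat \<Rightarrow> real) \<Rightarrow> (nat \<Rightarrow> 'a::real_inner) \<Rightarrow> real \<Rightarrow> 'a \<Rightarrow> real" where
  "dotH_norm lam e r x = norm (op_pow lam e (r / 2) x)"

definition hilbert_schmidt ::
    "(nat \<Rightarrow> 'u::real_inner) \<Rightarrow> ('u \<Rightarrow> 'h::real_inner) \<Rightarrow> bool" where
  "hilbert_schmidt phi B \<longleftrightarrow> bounded_linear B \<and> summable (\<lambda>j. (norm (B (phi j)))\<^sup>2)"

definition hs_norm :: "(nat \<Rightarrow> 'u::real_inner) \<Rightarrow> ('u \<Rightarrow> 'h::real_inner) \<Rightarrow> real" where
  "hs_norm phi B = sqrt (\<Sum>j. (norm (B (phi j)))\<^sup>2)"

text \<open>
  The Hilbert--Schmidt operators from \<open>Q\<^sup>1\<^sup>/\<^sup>2(U)\<close> to \<open>H\<close>, where \<open>Q\<close> has eigenvalues \<open>mu\<close> and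
  eigenvectors \<open>phi\<close>. Elements are total functions on \<open>U\<close>, but only their values on
  \<open>Q\<^sup>1\<^sup>/\<^sup>2(U)\<close> matter; they are linear there, need not extend to bounded operators on \<open>U\<close>, and
  their boundedness refers to the norm of \<open>Q\<^sup>1\<^sup>/\<^sup>2(U)\<close>, that is, to \<open>L \<circ> Q\<^sup>1\<^sup>/\<^sup>2\<close> being bounded
  on \<open>U\<close>.
\<close>

definition L20 ::
    "(nat \<Rightarrow> real) \<Rightarrow> (nat \<Rightarrow> 'u::real_inner) \<Rightarrow> ('u \<Rightarrow> 'h::real_inner) set" where
  "L20 mu phi = {L. hilbert_schmidt phi (L \<circ> op_pow mu phi (1/2))}"

definition L20_norm ::
    "(nat \<Rightarrow> real) \<Rightarrow> (nat \<Rightarrow> 'u::real_inner) \<Rightarrow> ('u \<Rightarrow> 'h::real_inner) \<Rightarrow> real" where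
  "L20_norm mu phi L = hs_norm phi (L \<circ> op_pow mu phi (1/2))"

section \<open>Norms of functions on the time interval\<close>

text \<open>
  The norm of the target space is the argument \<open>nrm\<close>. All function norms are extended
  nonnegative, so that a finite bound expresses membership in the corresponding space.
\<close>

definition eroot :: "real \<Rightarrow> ennreal \<Rightarrow> ennreal" where
  "eroot p x = (if x = \<top> then \<top> else ennreal (enn2real x powr (1 / p)))"

definition sup_norm :: "('e \<Rightarrow> real) \<Rightarrow> real \<Rightarrow> (real \<Rightarrow> 'e) \<Rightarrow> ennreal" where
  "sup_norm nrm T v = (SUP t\<in>{0..T}. ennreal (nrm (v t)))"

definition hoelder_norm ::
    "('e::minus \<Rightarrow> real) \<Rightarrow> real \<Rightarrow> real \<Rightarrow> (real \<Rightarrow> 'e) \<Rightarrow> ennreal" where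
  "hoelder_norm nrm T \<alpha> v = sup_norm nrm T v +
     (SUP (s, t)\<in>{(s, t). s \<in> {0..T} \<and> t \<in> {0..T} \<and> s \<noteq> t}.
        ennreal (nrm (v s - v t) * \<bar>s - t\<bar> powr (- \<alpha>)))"

definition slobodeckij_norm ::
    "('e::minus \<Rightarrow> real) \<Rightarrow> real \<Rightarrow> real \<Rightarrow> real \<Rightarrow> (real \<Rightarrow> 'e) \<Rightarrow> ennreal" where
  "slobodeckij_norm nrm T \<nu> p v = eroot p
     ((\<integral>\<^sup>+t\<in>{0..T}. ennreal (nrm (v t) powr p) \<partial>lborel) +
      (\<integral>\<^sup>+s\<in>{0..T}. (\<integral>\<^sup>+t\<in>{0..T}.
         ennreal (nrm (v s - v t) powr p / \<bar>s - t\<bar> powr (1 + \<nu> * p)) \<partial>lborel) \<partial>lborel))"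

definition L20_continuous ::
    "(nat \<Rightarrow> real) \<Rightarrow> (nat \<Rightarrow> 'u::real_inner) \<Rightarrow> real \<Rightarrow> (real \<Rightarrow> 'u \<Rightarrow> 'h::real_inner) \<Rightarrow> bool" where
  "L20_continuous mu phi T v \<longleftrightarrow> (\<forall>t\<in>{0..T}. v t \<in> L20 mu phi) \<and>
     (\<forall>t\<in>{0..T}. ((\<lambda>s. L20_norm mu phi (v s - v t)) \<longlongrightarrow> 0) (at t within {0..T}))"

definition test_function :: "real \<Rightarrow> (real \<Rightarrow> real) \<Rightarrow> bool" where
  "test_function T \<eta> \<longleftrightarrow> (\<forall>n x. ((deriv ^^ n) \<eta>) differentiable (at x)) \<and>
     (\<exists>a b. 0 < a \<and> b < T \<and> (\<forall>x. x \<notin> {a..b} \<longrightarrow> \<eta> x = 0))"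

text \<open>
  Weak derivatives of functions with values in the separable space of Hilbert--Schmidt operators
  \<open>L20 mu phi\<close>. Strong measurability and the Bochner integrals in the defining identity
  \<open>\<integral> \<eta>' v = - \<integral> \<eta> v'\<close> are expressed through the total family of continuous linear
  evaluation maps \<open>L \<mapsto> L (Q\<^sup>1\<^sup>/\<^sup>2 u)\<close>.
\<close>

definition L20_weak_deriv ::
    "(nat \<Rightarrow> real) \<Rightarrow> (nat \<Rightarrow> 'u::real_inner) \<Rightarrow> real \<Rightarrow>
     (real \<Rightarrow> 'u \<Rightarrow> 'h::{real_inner,banach,second_countable_topology}) \<Rightarrow>
     (real \<Rightarrow> 'u \<Rightarrow> 'h) \<Rightarrow> bool" where
  "L20_weak_deriv mu phi T v v' \<longleftrightarrow>
     (\<forall>t\<in>{0..T}. v' t \<in> L20 mu phi) \<and>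
     (\<forall>u. set_borel_measurable lborel {0..T} (\<lambda>t. v' t (op_pow mu phi (1/2) u))) \<and>
     (\<integral>\<^sup>+t\<in>{0..T}. ennreal (L20_norm mu phi (v' t)) \<partial>lborel) < \<infinity> \<and>
     (\<forall>\<eta> u. test_function T \<eta> \<longrightarrow>
        (LINT t:{0..T}|lborel. deriv \<eta> t *\<^sub>R v t (op_pow mu phi (1/2) u)) =
        - (LINT t:{0..T}|lborel. \<eta> t *\<^sub>R v' t (op_pow mu phi (1/2) u)))"

text \<open>
  For order 1 the infimum is over the weak derivatives, which are unique almost everywhere; it is
  infinite if there is none.
\<close>

definition L20_sobolev_norm ::
    "(nat \<Rightarrow> real) \<Rightarrow> (nat \<Rightarrow> 'u::real_inner) \<Rightarrow> real \<Rightarrow> real \<Rightarrow> real \<Rightarrow>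
     (real \<Rightarrow> 'u \<Rightarrow> 'h::{real_inner,banach,second_countable_topology}) \<Rightarrow> ennreal" where
  "L20_sobolev_norm mu phi T \<nu> p v =
     (if \<nu> = 1 then
        (INF v'\<in>{v'. L20_weak_deriv mu phi T v v'}. eroot p
          ((\<integral>\<^sup>+t\<in>{0..T}. ennreal (L20_norm mu phi (v t) powr p) \<partial>lborel) +
           (\<integral>\<^sup>+t\<in>{0..T}. ennreal (L20_norm mu phi (v' t) powr p) \<partial>lborel)))
      else slobodeckij_norm (L20_norm mu phi) T \<nu> p v)"

section \<open>Wiener process\<close>

definition usual_conditions :: "'w measure \<Rightarrow> real \<Rightarrow> (real \<Rightarrow> 'w measure) \<Rightarrow> bool" where
  "usual_conditions MW T FW \<longleftrightarrow> prob_space MW \<and>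
     (\<forall>t\<in>{0..T}. subalgebra MW (FW t)) \<and>
     (\<forall>s\<in>{0..T}. \<forall>t\<in>{s..T}. sets (FW s) \<subseteq> sets (FW t)) \<and>
     (\<forall>t\<in>{0..<T}. sets (FW t) = (\<Inter>s\<in>{t<..T}. sets (FW s))) \<and>
     null_sets MW \<subseteq> sets (FW 0)"

definition normal_rv :: "'w measure \<Rightarrow> real \<Rightarrow> real \<Rightarrow> ('w \<Rightarrow> real) \<Rightarrow> bool" where
  "normal_rv M m v X \<longleftrightarrow>
     (if v = 0 then X \<in> borel_measurable M \<and> (AE \<omega> in M. X \<omega> = m)
      else distributed M lborel X (normal_density m (sqrt v)))"

text \<open>The law \<open>N(0, (t - s) Q)\<close> on \<open>U\<close> is described by its one-dimensional projections.\<close>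

definition Q_Wiener_process ::
    "'w measure \<Rightarrow> real \<Rightarrow> (real \<Rightarrow> 'w measure) \<Rightarrow>
     ('u::{real_inner,second_countable_topology} \<Rightarrow> 'u) \<Rightarrow> (real \<Rightarrow> 'w \<Rightarrow> 'u) \<Rightarrow> bool" where
  "Q_Wiener_process MW T FW Q W \<longleftrightarrow>
     (\<forall>t\<in>{0..T}. W t \<in> borel_measurable (FW t)) \<and>
     (AE \<omega> in MW. W 0 \<omega> = 0) \<and>
     (AE \<omega> in MW. continuous_on {0..T} (\<lambda>t. W t \<omega>)) \<and>
     (\<forall>s\<in>{0..T}. \<forall>t\<in>{s..T}.
        prob_space.indep_set MW (sets (FW s))
          (sets (vimage_algebra (space MW) (\<lambda>\<omega>. W t \<omega> - W s \<omega>) borel)) \<and>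
        (\<forall>u. normal_rv MW 0 ((t - s) * (Q u \<bullet> u)) (\<lambda>\<omega>. (W t \<omega> - W s \<omega>) \<bullet> u)))"

text \<open>If \<open>mu j = 0\<close>, the quotient is 0 by the convention on division by 0.\<close>

definition beta ::
    "(nat \<Rightarrow> real) \<Rightarrow> (nat \<Rightarrow> 'u::real_inner) \<Rightarrow> (real \<Rightarrow> 'w \<Rightarrow> 'u) \<Rightarrow>
     nat \<Rightarrow> real \<Rightarrow> 'w \<Rightarrow> real" where
  "beta mu phi W j t \<omega> = (W t \<omega> \<bullet> phi j) / sqrt (mu j)"

definition truncated_noise ::
    "(nat \<Rightarrow> real) \<Rightarrow> (nat \<Rightarrow> 'u::real_inner) \<Rightarrow> (real \<Rightarrow> 'w \<Rightarrow> 'u) \<Rightarrow>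
     nat \<Rightarrow> real \<Rightarrow> 'w \<Rightarrow> 'u" where
  "truncated_noise mu phi W M t \<omega> = (\<Sum>j<M. (sqrt (mu j) * beta mu phi W j t \<omega>) *\<^sub>R phi j)"

definition noise_increment ::
    "(nat \<Rightarrow> real) \<Rightarrow> (nat \<Rightarrow> 'u::real_inner) \<Rightarrow> (real \<Rightarrow> 'w \<Rightarrow> 'u) \<Rightarrow>
     nat \<Rightarrow> real \<Rightarrow> real \<Rightarrow> 'w \<Rightarrow> 'u" where
  "noise_increment mu phi W M \<kappa> t \<omega> =
     truncated_noise mu phi W M (t + \<kappa>) \<omega> - truncated_noise mu phi W M t \<omega>"

section \<open>Spatial discretization\<close>

text \<open>Here and below, \<open>Vh\<close> is a single finite dimensional subspace of \<open>dotH lam e 1\<close>.\<close>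

definition orth_proj :: "'a::real_inner set \<Rightarrow> 'a \<Rightarrow> 'a" where
  "orth_proj Vh x = (THE y. y \<in> Vh \<and> (\<forall>z\<in>Vh. (x - y) \<bullet> z = 0))"

definition discrete_op ::
    "(nat \<Rightarrow> real) \<Rightarrow> (nat \<Rightarrow> 'a::real_inner) \<Rightarrow> 'a set \<Rightarrow> 'a \<Rightarrow> 'a" where
  "discrete_op lam e Vh x = (THE y. y \<in> Vh \<and> (\<forall>z\<in>Vh. y \<bullet> z = dotH_inner lam e 1 x z))"

definition S_op ::
    "(nat \<Rightarrow> real) \<Rightarrow> (nat \<Rightarrow> 'a::real_inner) \<Rightarrow> 'a set \<Rightarrow> real \<Rightarrow> 'a \<Rightarrow> 'a" where
  "S_op lam e Vh \<theta> x =
     the_inv_into Vh (\<lambda>y. y + \<theta> *\<^sub>R discrete_op lam e Vh y) (orth_proj Vh x)"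

section \<open>Randomized scheme\<close>

definition num_steps :: "real \<Rightarrow> real \<Rightarrow> nat" where
  "num_steps T k = nat \<lfloor>T / k\<rfloor>"

lemma num_steps_bounds:
  assumes "0 < k" "k < T"
  shows "real (num_steps T k) * k \<le> T" "T < (real (num_steps T k) + 1) * k"
    "1 \<le> num_steps T k"
proof -
  have "1 < T / k"
    using assms by simp
  then have "1 \<le> \<lfloor>T / k\<rfloor>"
    by linarith
  then have *: "real (num_steps T k) = of_int \<lfloor>T / k\<rfloor>" and "1 \<le> num_steps T k"
    by (auto simp: num_steps_def le_nat_iff)
  then show "1 \<le> num_steps T k" by simp
  show "real (num_steps T k) * k \<le> T" "T < (real (num_steps T k) + 1) * k"
    using floor_divide_lower[of k T] floor_divide_upper[of k T] assms by (simp_all only: *)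
qed

definition grid_time :: "real \<Rightarrow> nat \<Rightarrow> real" where
  "grid_time k n = real n * k"

definition tau_algebra :: "'t measure \<Rightarrow> (nat \<Rightarrow> 't \<Rightarrow> real) \<Rightarrow> nat \<Rightarrow> 't measure" where
  "tau_algebra MT \<tau> n =
     sigma (space MT) {\<tau> j -` B \<inter> space MT | j B. j \<in> {1..n} \<and> B \<in> sets borel}"

definition grid_algebra ::
    "(real \<Rightarrow> 'w measure) \<Rightarrow> 't measure \<Rightarrow> (nat \<Rightarrow> 't \<Rightarrow> real) \<Rightarrow> real \<Rightarrow> nat \<Rightarrow>
     ('w \<times> 't) measure" where
  "grid_algebra FW MT \<tau> k n = FW (grid_time k n) \<Otimes>\<^sub>M tau_algebra MT \<tau> n"

text \<open>In the next three definitions \<open>W\<close> is evaluated at the sample point \<open>\<omega>\<close>.\<close>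

definition Psi ::
    "(nat \<Rightarrow> real) \<Rightarrow> (nat \<Rightarrow> 'h::real_inner) \<Rightarrow> (nat \<Rightarrow> real) \<Rightarrow> (nat \<Rightarrow> 'u::real_inner) \<Rightarrow>
     (real \<Rightarrow> 'h \<Rightarrow> 'h) \<Rightarrow> (real \<Rightarrow> 'u \<Rightarrow> 'h) \<Rightarrow> (real \<Rightarrow> 'w \<Rightarrow> 'u) \<Rightarrow>
     'h set \<Rightarrow> real \<Rightarrow> nat \<Rightarrow> nat \<Rightarrow> 'h \<Rightarrow> real \<Rightarrow> 'w \<Rightarrow> 'h" where
  "Psi lam e mu phi f g W Vh k M j x \<theta> \<omega> = (let s = grid_time k (j - 1) in
     S_op lam e Vh (\<theta> * k)
       (x - (\<theta> * k) *\<^sub>R f s x + g s (noise_increment mu phi W M (\<theta> * k) s \<omega>)))"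

definition Phi ::
    "(nat \<Rightarrow> real) \<Rightarrow> (nat \<Rightarrow> 'h::real_inner) \<Rightarrow> (nat \<Rightarrow> real) \<Rightarrow> (nat \<Rightarrow> 'u::real_inner) \<Rightarrow>
     (real \<Rightarrow> 'h \<Rightarrow> 'h) \<Rightarrow> (real \<Rightarrow> 'u \<Rightarrow> 'h) \<Rightarrow> (real \<Rightarrow> 'w \<Rightarrow> 'u) \<Rightarrow>
     'h set \<Rightarrow> real \<Rightarrow> nat \<Rightarrow> nat \<Rightarrow> 'h \<Rightarrow> real \<Rightarrow> 'w \<Rightarrow> 'h" where
  "Phi lam e mu phi f g W Vh k M j x \<theta> \<omega> = (let s = grid_time k (j - 1) in
     - (k *\<^sub>R S_op lam e Vh k
          (f (s + \<theta> * k) (Psi lam e mu phi f g W Vh k M j x \<theta> \<omega>)))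
     + S_op lam e Vh k (g (s + \<theta> * k) (noise_increment mu phi W M k s \<omega>)))"

definition residual ::
    "(nat \<Rightarrow> real) \<Rightarrow> (nat \<Rightarrow> 'h::real_inner) \<Rightarrow> (nat \<Rightarrow> real) \<Rightarrow> (nat \<Rightarrow> 'u::real_inner) \<Rightarrow>
     (real \<Rightarrow> 'h \<Rightarrow> 'h) \<Rightarrow> (real \<Rightarrow> 'u \<Rightarrow> 'h) \<Rightarrow> (real \<Rightarrow> 'w \<Rightarrow> 'u) \<Rightarrow>
     ('w \<Rightarrow> 'h) \<Rightarrow> (nat \<Rightarrow> 't \<Rightarrow> real) \<Rightarrow> 'h set \<Rightarrow> real \<Rightarrow> nat \<Rightarrow>
     (nat \<Rightarrow> 'w \<times> 't \<Rightarrow> 'h) \<Rightarrow> nat \<Rightarrow> 'w \<times> 't \<Rightarrow> 'h" where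
  "residual lam e mu phi f g W X0 \<tau> Vh k M Z n = (\<lambda>(\<omega>, \<omega>').
     if n = 0 then Z 0 (\<omega>, \<omega>') - orth_proj Vh (X0 \<omega>)
     else Z n (\<omega>, \<omega>') - S_op lam e Vh k (Z (n - 1) (\<omega>, \<omega>'))
            - Phi lam e mu phi f g W Vh k M n (Z (n - 1) (\<omega>, \<omega>')) (\<tau> n \<omega>') \<omega>)"

section \<open>Grid functions and norms\<close>

text \<open>
  The representatives of the elements of \<open>L\<^sup>p(\<Omega>, F, P; H)\<close>, where \<open>F\<close> is a sub-\<open>\<sigma>\<close>-algebra: all
  functions that agree almost surely with an \<open>F\<close>-measurable one and have finite \<open>p\<close>-th moment.
\<close>

definition Lp_functions ::
    "'a measure \<Rightarrow> 'a measure \<Rightarrow> real \<Rightarrow> ('a \<Rightarrow> 'h::real_normed_vector) set" where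
  "Lp_functions P F p = {X.
     (\<exists>X'\<in>borel_measurable F. AE \<omega> in P. X \<omega> = X' \<omega>) \<and>
     (\<integral>\<^sup>+\<omega>. ennreal (norm (X \<omega>) powr p) \<partial>P) < \<infinity>}"

text \<open>
  A nonnegative integral is used since representatives in \<open>Lp_functions\<close> need not be measurable;
  it is finite for all functions to which the norm is applied.
\<close>

definition Lp_norm :: "'a measure \<Rightarrow> real \<Rightarrow> ('a \<Rightarrow> 'h::real_normed_vector) \<Rightarrow> real" where
  "Lp_norm P p X = enn2real (\<integral>\<^sup>+\<omega>. ennreal (norm (X \<omega>) powr p) \<partial>P) powr (1 / p)"

text \<open>
  Representatives of grid functions are defined for all \<open>n\<close>; only \<open>n \<le> num_steps T k\<close> matters.
  The elements of the space of grid functions are the classes with respect to \<open>grid_ae_eq\<close>.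
\<close>

definition grid_functions ::
    "'w measure \<Rightarrow> (real \<Rightarrow> 'w measure) \<Rightarrow> 't measure \<Rightarrow> (nat \<Rightarrow> 't \<Rightarrow> real) \<Rightarrow>
     real \<Rightarrow> real \<Rightarrow> real \<Rightarrow> (nat \<Rightarrow> 'w \<times> 't \<Rightarrow> 'h::real_normed_vector) set" where
  "grid_functions MW FW MT \<tau> T p k =
     {Z. \<forall>n\<le>num_steps T k. Z n \<in> Lp_functions (MW \<Otimes>\<^sub>M MT) (grid_algebra FW MT \<tau> k n) p}"

definition grid_ae_eq ::
    "'w measure \<Rightarrow> (real \<Rightarrow> 'w measure) \<Rightarrow> 't measure \<Rightarrow> (nat \<Rightarrow> 't \<Rightarrow> real) \<Rightarrow>
     real \<Rightarrow> real \<Rightarrow> real \<Rightarrow> (nat \<Rightarrow> 'w \<times> 't \<Rightarrow> 'h::real_normed_vector) rel" where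
  "grid_ae_eq MW FW MT \<tau> T p k =
     {(Y, Z). Y \<in> grid_functions MW FW MT \<tau> T p k \<and> Z \<in> grid_functions MW FW MT \<tau> T p k \<and>
        (\<forall>n\<le>num_steps T k. AE \<omega> in MW \<Otimes>\<^sub>M MT. Y n \<omega> = Z n \<omega>)}"

definition grid_norm_inf ::
    "'a measure \<Rightarrow> real \<Rightarrow> real \<Rightarrow> real \<Rightarrow> (nat \<Rightarrow> 'a \<Rightarrow> 'h::real_normed_vector) \<Rightarrow> real" where
  "grid_norm_inf P T p k Z = (MAX n\<in>{0..num_steps T k}. Lp_norm P p (Z n))"

definition grid_norm_S ::
    "'a measure \<Rightarrow> (nat \<Rightarrow> real) \<Rightarrow> (nat \<Rightarrow> 'h::real_inner) \<Rightarrow> 'h set \<Rightarrow>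
     real \<Rightarrow> real \<Rightarrow> real \<Rightarrow> (nat \<Rightarrow> 'a \<Rightarrow> 'h) \<Rightarrow> real" where
  "grid_norm_S P lam e Vh T p k Z = Lp_norm P p (Z 0) +
     (MAX n\<in>{1..num_steps T k}.
        Lp_norm P p (\<lambda>\<omega>. \<Sum>j=1..n. (S_op lam e Vh k ^^ (n - j)) (Z j \<omega>)))"

end

theory Submission
  imports Defs
begin

text \<open>
  The noise of the scheme is additive: the diffusion coefficient does not depend on the state. Two
  grid functions are therefore driven by the same noise terms, which cancel when the scheme is
  applied to both and the results are subtracted. What remains of the increment is a composition of
  the drift, which is Lipschitz continuous, with the resolvents \<open>S\<^sub>\<theta>\<^sub>,\<^sub>h = (Id + \<theta> A\<^sub>h)\<^sup>-\<^sup>1 P\<^sub>h\<close>, which are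
  contractions because \<open>A\<^sub>h\<close> is nonnegative. For almost every realization the increment thus has
  Lipschitz constant \<open>k Cf (1 + T Cf)\<close> (\<open>Phi_lipschitz\<close>). Neither the number of noise terms nor the
  Galerkin space enters this constant.

  Bistability is then a pathwise computation. For grid functions \<open>Y\<close> and \<open>Z\<close> with \<open>E = Y - Z\<close> and
  \<open>D = R[Y] - R[Z]\<close>, iterating the definition of the residual gives (\<open>variation_of_constants\<close>)
  \<open>E\<^sub>n = S\<^sup>n E\<^sub>0 + (\<Sum>j=1..n. S\<^sup>n\<^sup>-\<^sup>j D\<^sub>j) + (\<Sum>j=1..n. S\<^sup>n\<^sup>-\<^sup>j (\<Phi>\<^sub>j(Y\<^sub>j\<^sub>-\<^sub>1) - \<Phi>\<^sub>j(Z\<^sub>j\<^sub>-\<^sub>1)))\<close>.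
  The last sum is at most \<open>k Cf (1 + T Cf)\<close> times the sum of the earlier \<open>\<parallel>E\<^sub>j\<parallel>\<close>. Solving for the sum of
  residuals and taking \<open>L\<^sup>p\<close> norms with Minkowski's inequality (\<open>Lp_add\<close>) bounds the stability norm of \<open>D\<close>
  by the maximum norm of \<open>E\<close> (\<open>norm_S_le_norm_inf\<close>); solving for \<open>E\<^sub>n\<close> and applying Gronwall's inequality
  gives the converse (\<open>norm_inf_le_norm_S\<close>). As there are at most \<open>T / k\<close> steps, the constants are uniform.

  That the residual operator is a bijection follows from the scheme being explicit: a prescribed
  residual can be solved for step by step (\<open>res_surj\<close>, \<open>res_eq_iff\<close>). This requires that one step maps
  adapted \<open>p\<close>-integrable states to adapted \<open>p\<close>-integrable states (\<open>increment_Lp\<close>), which is the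
  probabilistic part of the proof. The Wiener process is evaluated at a random time there; its
  continuous paths give measurability, and the Gaussian moments at deterministic times give
  integrability by Fubini's theorem (\<open>Lp_functions_random_time\<close>). The resolvents are evaluated at a
  random time as well and depend continuously on it by the resolvent identity (\<open>continuous_on_S_op\<close>).
\<close>

section \<open>Spaces of p-integrable random variables\<close>

lemma Lp_norm_nonneg: "0 \<le> Lp_norm P p X"
  by (simp add: Lp_norm_def)

lemma Lp_norm_leI:
  assumes "0 < p" "0 \<le> c" "(\<integral>\<^sup>+\<omega>. ennreal (norm (X \<omega>) powr p) \<partial>P) \<le> ennreal (c powr p)"
  shows "Lp_norm P p X \<le> c"
proof -
  have "enn2real (\<integral>\<^sup>+\<omega>. ennreal (norm (X \<omega>) powr p) \<partial>P) \<le> c powr p"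
    using assms(3) by (simp add: enn2real_leI)
  then have "Lp_norm P p X \<le> (c powr p) powr (1 / p)"
    unfolding Lp_norm_def using assms(1) by (intro powr_mono2) auto
  then show ?thesis
    using assms(1,2) by (simp add: powr_powr)
qed

lemma nn_integral_norm_powr_eq_Lp_norm:
  assumes "0 < p" "X \<in> Lp_functions P F p"
  shows "(\<integral>\<^sup>+\<omega>. ennreal (norm (X \<omega>) powr p) \<partial>P) = ennreal (Lp_norm P p X powr p)"
  using assms by (simp add: Lp_norm_def Lp_functions_def powr_powr ennreal_enn2real less_top)

lemma Lp_functions_mono:
  assumes "subalgebra F' F"
  shows "Lp_functions P F p \<subseteq> Lp_functions P F' p"
  using measurable_from_subalg[OF assms] by (auto simp: Lp_functions_def)

text \<open>
  Elements of \<^const>\<open>Lp_functions\<close> are almost surely equal to measurable functions, but need not be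
  measurable themselves. The following lemmas therefore work with almost sure representatives.
\<close>

lemma Lp_functions_dominated:
  assumes "0 < p" "X \<in> Lp_functions P F p"
    and "\<exists>Y'\<in>borel_measurable F'. AE \<omega> in P. Y \<omega> = Y' \<omega>"
    and "AE \<omega> in P. norm (Y \<omega>) \<le> norm (X \<omega>)"
  shows "Y \<in> Lp_functions P F' p"
proof -
  have "(\<integral>\<^sup>+\<omega>. ennreal (norm (Y \<omega>) powr p) \<partial>P) \<le> (\<integral>\<^sup>+\<omega>. ennreal (norm (X \<omega>) powr p) \<partial>P)"
    using assms(4) by (intro nn_integral_mono_AE)
      (auto elim!: eventually_mono intro!: ennreal_leI powr_mono2 less_imp_le[OF assms(1)])
  then show ?thesis
    using assms(2,3) by (auto simp: Lp_functions_def)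
qed

lemma Lp_norm_mono_AE:
  assumes "0 < p" "X \<in> Lp_functions P F p" "AE \<omega> in P. norm (Y \<omega>) \<le> norm (X \<omega>)"
  shows "Lp_norm P p Y \<le> Lp_norm P p X"
proof (rule Lp_norm_leI[OF assms(1) Lp_norm_nonneg])
  have "(\<integral>\<^sup>+\<omega>. ennreal (norm (Y \<omega>) powr p) \<partial>P) \<le> (\<integral>\<^sup>+\<omega>. ennreal (norm (X \<omega>) powr p) \<partial>P)"
    using assms(3) by (intro nn_integral_mono_AE)
      (auto elim!: eventually_mono intro!: ennreal_leI powr_mono2 less_imp_le[OF assms(1)])
  then show "(\<integral>\<^sup>+\<omega>. ennreal (norm (Y \<omega>) powr p) \<partial>P) \<le> ennreal (Lp_norm P p X powr p)"
    by (simp add: nn_integral_norm_powr_eq_Lp_norm[OF assms(1,2)])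
qed

lemma Lp_functions_norm:
  assumes "X \<in> Lp_functions P F p"
  shows "(\<lambda>\<omega>. norm (X \<omega>)) \<in> Lp_functions P F p"
proof -
  obtain X' where X': "X' \<in> borel_measurable F" "AE \<omega> in P. X \<omega> = X' \<omega>"
    using assms by (auto simp: Lp_functions_def)
  have "(\<lambda>\<omega>. norm (X' \<omega>)) \<in> borel_measurable F"
    using X'(1) by measurable
  moreover have "AE \<omega> in P. norm (X \<omega>) = norm (X' \<omega>)"
    using X'(2) by auto
  ultimately show ?thesis
    using assms by (auto simp: Lp_functions_def)
qed

lemma Lp_norm_norm: "Lp_norm P p (\<lambda>\<omega>. norm (X \<omega>)) = Lp_norm P p X"
  by (simp add: Lp_norm_def)

text \<open>
  Convexity of \<open>x\<^sup>p\<close>, applied to \<open>(u + v) / (a + b)\<close> as the convex combination of \<open>u / a\<close> and \<open>v / b\<close>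
  with weights \<open>a / (a + b)\<close> and \<open>b / (a + b)\<close>.
\<close>

lemma powr_add_le_weighted:
  fixes a b u v p :: real
  assumes "1 \<le> p" "0 < a" "0 < b" "0 \<le> u" "0 \<le> v"
  shows "(u + v) powr p \<le> (a + b) powr (p - 1) * (a powr (1 - p) * u powr p + b powr (1 - p) * v powr p)"
proof -
  have convex: "convex_on {0..} (\<lambda>x::real. x powr p)"
  proof (rule convex_onI)
    fix t x y :: real
    assume t: "0 < t" "t < 1" and "x \<in> {0..}" "y \<in> {0..}"
    \<comment> \<open>Convexity on the open half line does not cover \<open>x = 0\<close> and \<open>y = 0\<close>, where it says \<open>s\<^sup>p \<le> s\<close>.\<close>
    have small: "s powr p \<le> s" if "0 < s" "s < 1" for s :: real
      using powr_mono'[of 1 p s] that assms(1) by simp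
    consider "x = 0" | "y = 0" | "0 < x" "0 < y"
      using \<open>x \<in> {0..}\<close> \<open>y \<in> {0..}\<close> by fastforce
    then show "((1 - t) *\<^sub>R x + t *\<^sub>R y) powr p \<le> (1 - t) * x powr p + t * y powr p"
    proof cases
      case 1
      then show ?thesis
        using small[of t] t \<open>y \<in> {0..}\<close> by (auto simp: powr_mult intro!: mult_right_mono)
    next
      case 2
      then show ?thesis
        using small[of "1 - t"] t \<open>x \<in> {0..}\<close> by (auto simp: powr_mult intro!: mult_right_mono)
    next
      case 3
      then show ?thesis
        using convex_onD[OF powr_convex[OF assms(1)], of t x y] t by auto
    qed
  qed simp
  define t where "t = b / (a + b)"
  have t: "0 \<le> t" "t \<le> 1" and t': "1 - t = a / (a + b)"
    using assms by (auto simp: t_def field_simps)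
  have "(u + v) / (a + b) = (1 - t) *\<^sub>R (u / a) + t *\<^sub>R (v / b)"
    unfolding t' unfolding t_def using assms(2,3) by (simp add: add_divide_distrib)
  then have "((u + v) / (a + b)) powr p = ((1 - t) *\<^sub>R (u / a) + t *\<^sub>R (v / b)) powr p"
    by simp
  also have "\<dots> \<le> (1 - t) * (u / a) powr p + t * (v / b) powr p"
    using convex_onD[OF convex t, of "u / a" "v / b"] assms by simp
  also have "\<dots> = (a powr (1 - p) * u powr p + b powr (1 - p) * v powr p) / (a + b)"
    using assms unfolding t' unfolding t_def by (simp add: powr_divide powr_diff add_divide_distrib mult.commute)
  also have "((u + v) / (a + b)) powr p = (u + v) powr p / (a + b) powr p"
    using assms by (simp add: powr_divide)
  finally have "(u + v) powr p
      \<le> (a + b) powr p * ((a powr (1 - p) * u powr p + b powr (1 - p) * v powr p) / (a + b))"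
    using assms by (simp add: pos_divide_le_eq mult.commute)
  then show ?thesis
    using assms by (simp add: powr_diff)
qed

text \<open>
  Minkowski's inequality. Integrating \<open>powr_add_le_weighted\<close> with numbers \<open>a\<close> and \<open>b\<close> that exceed the
  two norms bounds the \<open>p\<close>-th moment of the sum by \<open>(a + b)\<^sup>p\<close>; then \<open>a\<close> and \<open>b\<close> decrease to the norms.
  Taking them strictly larger covers the case of vanishing norms.
\<close>

lemma Lp_add:
  fixes X Y :: "'a \<Rightarrow> 'h::{real_normed_vector,second_countable_topology}"
  assumes p: "1 \<le> p" and F: "subalgebra P F"
    and X: "X \<in> Lp_functions P F p" and Y: "Y \<in> Lp_functions P F p"
  shows "(\<lambda>\<omega>. X \<omega> + Y \<omega>) \<in> Lp_functions P F p"
    and "Lp_norm P p (\<lambda>\<omega>. X \<omega> + Y \<omega>) \<le> Lp_norm P p X + Lp_norm P p Y"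
proof -
  have p0: "0 < p" using p by simp
  obtain X' Y' where X': "X' \<in> borel_measurable F" "AE \<omega> in P. X \<omega> = X' \<omega>"
    and Y': "Y' \<in> borel_measurable F" "AE \<omega> in P. Y \<omega> = Y' \<omega>"
    using X Y by (auto simp: Lp_functions_def)
  have XP: "X' \<in> borel_measurable P" and YP: "Y' \<in> borel_measurable P"
    using measurable_from_subalg[OF F] X'(1) Y'(1) by blast+
  have bound: "(\<integral>\<^sup>+\<omega>. ennreal (norm (X \<omega> + Y \<omega>) powr p) \<partial>P) \<le> ennreal ((a + b) powr p)"
    if a: "Lp_norm P p X < a" and b: "Lp_norm P p Y < b" for a b
  proof -
    have ab: "0 < a" "0 < b"
      using a b Lp_norm_nonneg[of P p X] Lp_norm_nonneg[of P p Y] by auto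
    let ?c = "(a + b) powr (p - 1)"
    have "(\<integral>\<^sup>+\<omega>. ennreal (norm (X \<omega> + Y \<omega>) powr p) \<partial>P)
        \<le> (\<integral>\<^sup>+\<omega>. ennreal (?c * a powr (1 - p)) * ennreal (norm (X' \<omega>) powr p)
             + ennreal (?c * b powr (1 - p)) * ennreal (norm (Y' \<omega>) powr p) \<partial>P)"
    proof (rule nn_integral_mono_AE, use X'(2) Y'(2) in eventually_elim)
      case (elim \<omega>)
      have "norm (X \<omega> + Y \<omega>) powr p \<le> (norm (X \<omega>) + norm (Y \<omega>)) powr p"
        using p by (intro powr_mono2 norm_triangle_ineq) auto
      also have "\<dots> \<le> ?c * a powr (1 - p) * norm (X \<omega>) powr p + ?c * b powr (1 - p) * norm (Y \<omega>) powr p"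
        using powr_add_le_weighted[OF p ab, of "norm (X \<omega>)" "norm (Y \<omega>)"]
        by (simp add: distrib_left mult.assoc)
      finally show ?case
        by (simp add: elim ennreal_mult[symmetric] ennreal_plus[symmetric] del: ennreal_plus)
    qed
    also have "\<dots> = ennreal (?c * a powr (1 - p)) * (\<integral>\<^sup>+\<omega>. ennreal (norm (X' \<omega>) powr p) \<partial>P)
        + ennreal (?c * b powr (1 - p)) * (\<integral>\<^sup>+\<omega>. ennreal (norm (Y' \<omega>) powr p) \<partial>P)"
      using XP YP by (subst nn_integral_add) (auto simp: nn_integral_cmult)
    also have "(\<integral>\<^sup>+\<omega>. ennreal (norm (X' \<omega>) powr p) \<partial>P) = (\<integral>\<^sup>+\<omega>. ennreal (norm (X \<omega>) powr p) \<partial>P)"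
      using X'(2) by (intro nn_integral_cong_AE) auto
    also have "(\<integral>\<^sup>+\<omega>. ennreal (norm (Y' \<omega>) powr p) \<partial>P) = (\<integral>\<^sup>+\<omega>. ennreal (norm (Y \<omega>) powr p) \<partial>P)"
      using Y'(2) by (intro nn_integral_cong_AE) auto
    also have "ennreal (?c * a powr (1 - p)) * (\<integral>\<^sup>+\<omega>. ennreal (norm (X \<omega>) powr p) \<partial>P)
        + ennreal (?c * b powr (1 - p)) * (\<integral>\<^sup>+\<omega>. ennreal (norm (Y \<omega>) powr p) \<partial>P)
        \<le> ennreal (?c * a powr (1 - p)) * ennreal (a powr p)
        + ennreal (?c * b powr (1 - p)) * ennreal (b powr p)"
      unfolding nn_integral_norm_powr_eq_Lp_norm[OF p0 X] nn_integral_norm_powr_eq_Lp_norm[OF p0 Y]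
      using a b p by (intro add_mono mult_left_mono ennreal_leI powr_mono2) (auto simp: Lp_norm_nonneg)
    also have "\<dots> = ennreal (?c * (a powr (1 - p) * a powr p + b powr (1 - p) * b powr p))"
      by (simp add: ennreal_mult[symmetric] ennreal_plus[symmetric] distrib_left mult.assoc del: ennreal_plus)
    also have "?c * (a powr (1 - p) * a powr p + b powr (1 - p) * b powr p) = (a + b) powr p"
      using ab by (simp flip: powr_add) (simp add: powr_diff)
    finally show ?thesis .
  qed
  have "(\<lambda>\<omega>. X' \<omega> + Y' \<omega>) \<in> borel_measurable F" "AE \<omega> in P. X \<omega> + Y \<omega> = X' \<omega> + Y' \<omega>"
    using X' Y' by auto
  moreover have "(\<integral>\<^sup>+\<omega>. ennreal (norm (X \<omega> + Y \<omega>) powr p) \<partial>P) < \<infinity>"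
    using bound[of "Lp_norm P p X + 1" "Lp_norm P p Y + 1"] by (auto simp: le_less_trans)
  ultimately show "(\<lambda>\<omega>. X \<omega> + Y \<omega>) \<in> Lp_functions P F p"
    by (auto simp: Lp_functions_def)
  show "Lp_norm P p (\<lambda>\<omega>. X \<omega> + Y \<omega>) \<le> Lp_norm P p X + Lp_norm P p Y"
  proof (rule field_le_epsilon)
    fix \<epsilon> :: real assume "0 < \<epsilon>"
    then show "Lp_norm P p (\<lambda>\<omega>. X \<omega> + Y \<omega>) \<le> Lp_norm P p X + Lp_norm P p Y + \<epsilon>"
      using bound[of "Lp_norm P p X + \<epsilon> / 2" "Lp_norm P p Y + \<epsilon> / 2"]
      by (intro Lp_norm_leI[OF p0]) (auto simp: Lp_norm_nonneg algebra_simps)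
  qed
qed

lemma Lp_scaleR:
  fixes X :: "'a \<Rightarrow> 'h::{real_normed_vector,second_countable_topology}"
  assumes p: "1 \<le> p" and F: "subalgebra P F" and X: "X \<in> Lp_functions P F p"
  shows "(\<lambda>\<omega>. c *\<^sub>R X \<omega>) \<in> Lp_functions P F p"
    and "Lp_norm P p (\<lambda>\<omega>. c *\<^sub>R X \<omega>) \<le> \<bar>c\<bar> * Lp_norm P p X"
proof -
  have p0: "0 < p" using p by simp
  obtain X' where X': "X' \<in> borel_measurable F" "AE \<omega> in P. X \<omega> = X' \<omega>"
    using X by (auto simp: Lp_functions_def)
  have XP: "X' \<in> borel_measurable P"
    using measurable_from_subalg[OF F] X'(1) by blast
  have "(\<integral>\<^sup>+\<omega>. ennreal (norm (c *\<^sub>R X \<omega>) powr p) \<partial>P)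
      = (\<integral>\<^sup>+\<omega>. ennreal (\<bar>c\<bar> powr p) * ennreal (norm (X' \<omega>) powr p) \<partial>P)"
    using X'(2) by (intro nn_integral_cong_AE) (auto simp: powr_mult ennreal_mult)
  also have "\<dots> = ennreal (\<bar>c\<bar> powr p) * (\<integral>\<^sup>+\<omega>. ennreal (norm (X' \<omega>) powr p) \<partial>P)"
    using XP by (intro nn_integral_cmult) auto
  also have "(\<integral>\<^sup>+\<omega>. ennreal (norm (X' \<omega>) powr p) \<partial>P) = (\<integral>\<^sup>+\<omega>. ennreal (norm (X \<omega>) powr p) \<partial>P)"
    using X'(2) by (intro nn_integral_cong_AE) auto
  also have "ennreal (\<bar>c\<bar> powr p) * \<dots> = ennreal ((\<bar>c\<bar> * Lp_norm P p X) powr p)"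
    unfolding nn_integral_norm_powr_eq_Lp_norm[OF p0 X]
    by (simp add: powr_mult Lp_norm_nonneg ennreal_mult)
  finally have I: "(\<integral>\<^sup>+\<omega>. ennreal (norm (c *\<^sub>R X \<omega>) powr p) \<partial>P) = ennreal ((\<bar>c\<bar> * Lp_norm P p X) powr p)" .
  then show "Lp_norm P p (\<lambda>\<omega>. c *\<^sub>R X \<omega>) \<le> \<bar>c\<bar> * Lp_norm P p X"
    by (intro Lp_norm_leI[OF p0]) (auto simp: Lp_norm_nonneg)
  have "(\<lambda>\<omega>. c *\<^sub>R X' \<omega>) \<in> borel_measurable F" "AE \<omega> in P. c *\<^sub>R X \<omega> = c *\<^sub>R X' \<omega>"
    using X' by auto
  moreover have "(\<integral>\<^sup>+\<omega>. ennreal (norm (c *\<^sub>R X \<omega>) powr p) \<partial>P) < \<infinity>"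
    unfolding I by simp
  ultimately show "(\<lambda>\<omega>. c *\<^sub>R X \<omega>) \<in> Lp_functions P F p"
    unfolding Lp_functions_def by (intro CollectI conjI bexI[where x = "\<lambda>\<omega>. c *\<^sub>R X' \<omega>"])
qed

lemma Lp_diff:
  fixes X Y :: "'a \<Rightarrow> 'h::{real_normed_vector,second_countable_topology}"
  assumes "1 \<le> p" "subalgebra P F" "X \<in> Lp_functions P F p" "Y \<in> Lp_functions P F p"
  shows "(\<lambda>\<omega>. X \<omega> - Y \<omega>) \<in> Lp_functions P F p"
  using Lp_add(1)[OF assms(1-3) Lp_scaleR(1)[OF assms(1,2,4), of "-1"]] by simp

lemma Lp_const:
  assumes "prob_space P"
  shows "(\<lambda>_. c) \<in> Lp_functions P F p"
proof -
  interpret prob_space P by fact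
  show ?thesis
    by (auto simp: Lp_functions_def emeasure_space_1)
qed

lemma Lp_sum:
  fixes X :: "'i \<Rightarrow> 'a \<Rightarrow> 'h::{real_normed_vector,second_countable_topology}"
  assumes "1 \<le> p" "subalgebra P F" "\<And>i. i \<in> I \<Longrightarrow> X i \<in> Lp_functions P F p"
  shows "(\<lambda>\<omega>. \<Sum>i\<in>I. X i \<omega>) \<in> Lp_functions P F p \<and>
    Lp_norm P p (\<lambda>\<omega>. \<Sum>i\<in>I. X i \<omega>) \<le> (\<Sum>i\<in>I. Lp_norm P p (X i))"
  using assms(3)
proof (induction I rule: infinite_finite_induct)
  case (insert i I)
  then have IH: "(\<lambda>\<omega>. \<Sum>i\<in>I. X i \<omega>) \<in> Lp_functions P F p"
      "Lp_norm P p (\<lambda>\<omega>. \<Sum>i\<in>I. X i \<omega>) \<le> (\<Sum>i\<in>I. Lp_norm P p (X i))"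
    and i: "X i \<in> Lp_functions P F p"
    by auto
  show ?case
    using insert.hyps Lp_add[OF assms(1,2) i IH(1)] IH(2) by auto
qed (use \<open>1 \<le> p\<close> in \<open>auto simp: Lp_functions_def Lp_norm_def\<close>)

lemma Lp_functions_lipschitz_image:
  fixes G :: "'h::{real_normed_vector,second_countable_topology} \<Rightarrow> 'h"
  assumes "0 < p" "X \<in> Lp_functions P F p" "continuous_on UNIV G" "\<And>x. norm (G x) \<le> norm x"
  shows "(\<lambda>\<omega>. G (X \<omega>)) \<in> Lp_functions P F p"
proof (rule Lp_functions_dominated[OF assms(1,2)])
  obtain X' where X': "X' \<in> borel_measurable F" "AE \<omega> in P. X \<omega> = X' \<omega>"
    using assms(2) by (auto simp: Lp_functions_def)
  have "(\<lambda>\<omega>. G (X' \<omega>)) \<in> borel_measurable F"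
    using borel_measurable_continuous_onI[OF assms(3)] X'(1) by measurable
  moreover have "AE \<omega> in P. G (X \<omega>) = G (X' \<omega>)"
    using X'(2) by auto
  ultimately show "\<exists>Y'\<in>borel_measurable F. AE \<omega> in P. G (X \<omega>) = Y' \<omega>"
    by (intro bexI[where x = "\<lambda>\<omega>. G (X' \<omega>)"])
qed (use assms(4) in auto)

section \<open>Bijections of quotients\<close>

text \<open>
  Respecting the relation makes the induced map on classes well defined, reflecting it makes that
  map injective, and solvability up to the relation makes it onto.
\<close>

lemma bij_betw_quotient:
  assumes eq: "equiv G E" and R: "R \<in> G \<rightarrow> G"
    and inj: "\<And>Y Z. Y \<in> G \<Longrightarrow> Z \<in> G \<Longrightarrow> (R Y, R Z) \<in> E \<longleftrightarrow> (Y, Z) \<in> E"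
    and surj: "\<And>Y. Y \<in> G \<Longrightarrow> \<exists>Z\<in>G. (R Z, Y) \<in> E"
  shows "(\<lambda>Z. E `` {R Z}) respects E"
    and "bij_betw (\<lambda>c. \<Union>Z\<in>c. E `` {R Z}) (G // E) (G // E)"
proof -
  have in_G: "Y \<in> G" "Z \<in> G" if "(Y, Z) \<in> E" for Y Z
    using that eq by (auto simp: equiv_def refl_on_def)
  show resp: "(\<lambda>Z. E `` {R Z}) respects E"
    using in_G inj equiv_class_eq[OF eq] by (intro congruentI) metis
  have image: "(\<Union>Z\<in>E `` {Y}. E `` {R Z}) = E `` {R Y}" if "Y \<in> G" for Y
    using UN_equiv_class[OF eq resp that] .
  show "bij_betw (\<lambda>c. \<Union>Z\<in>c. E `` {R Z}) (G // E) (G // E)"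
  proof (rule bij_betwI')
    fix c d assume "c \<in> G // E" "d \<in> G // E"
    then obtain Y Z where "c = E `` {Y}" "Y \<in> G" "d = E `` {Z}" "Z \<in> G"
      by (auto elim!: quotientE)
    then show "((\<Union>Z\<in>c. E `` {R Z}) = (\<Union>Z\<in>d. E `` {R Z})) = (c = d)"
      using R inj by (auto simp: image eq_equiv_class_iff[OF eq] Pi_iff)
  next
    fix c assume "c \<in> G // E"
    then show "(\<Union>Z\<in>c. E `` {R Z}) \<in> G // E"
      using R by (auto elim!: quotientE simp: image intro!: quotientI)
  next
    fix c assume "c \<in> G // E"
    then obtain Y where Y: "c = E `` {Y}" "Y \<in> G"
      by (auto elim!: quotientE)
    then obtain Z where Z: "Z \<in> G" "(R Z, Y) \<in> E"
      using surj by blast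
    then have "c = (\<Union>Z\<in>E `` {Z}. E `` {R Z})"
      using equiv_class_eq[OF eq Z(2)] Y by (simp add: image)
    then show "\<exists>d\<in>G // E. c = (\<Union>Z\<in>d. E `` {R Z})"
      using Z(1) by (auto intro: quotientI)
  qed
qed

section \<open>Bistability of abstract one-step methods\<close>

lemma discrete_gronwall:
  fixes a :: "nat \<Rightarrow> real"
  assumes "0 \<le> \<kappa>" "0 \<le> D" "\<And>n. n \<le> N \<Longrightarrow> a n \<le> D + \<kappa> * (\<Sum>j<n. a j)" "n \<le> N"
  shows "a n \<le> D * (1 + \<kappa>) ^ n"
  using assms(4)
proof (induction n rule: less_induct)
  case (less n)
  have "a n \<le> D + \<kappa> * (\<Sum>j<n. a j)"
    using assms(3) less.prems .
  also have "\<dots> \<le> D + \<kappa> * (\<Sum>j<n. D * (1 + \<kappa>) ^ j)"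
    using less assms(1) by (intro add_left_mono mult_left_mono sum_mono) auto
  also have "\<dots> = D * (1 + \<kappa> * (\<Sum>j<n. (1 + \<kappa>) ^ j))"
    by (simp add: sum_distrib_left algebra_simps)
  also have "1 + \<kappa> * (\<Sum>j<n. (1 + \<kappa>) ^ j) = (1 + \<kappa>) ^ n"
    using power_diff_1_eq[of "1 + \<kappa>" n] by simp
  finally show ?case .
qed

text \<open>
  What the bistability of an explicit method \<open>Z\<^sub>n = S Z\<^sub>n\<^sub>-\<^sub>1 + \<Phi>\<^sub>n(Z\<^sub>n\<^sub>-\<^sub>1)\<close> rests on: \<open>S\<close> is a linear
  contraction, one step preserves integrability and adaptedness, and for almost every realization
  the increments \<open>\<Phi>\<^sub>n\<close> are Lipschitz continuous with a constant \<open>\<kappa>\<close>. The stability constants only depend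
  on the product \<open>N \<kappa>\<close>, which stays bounded if \<open>\<kappa>\<close> is of the order of the step size.
\<close>

locale one_step_method =
  fixes P :: "'a measure" and F :: "nat \<Rightarrow> 'a measure" and p \<kappa> :: real and N :: nat
    and S :: "'h::{real_normed_vector,second_countable_topology} \<Rightarrow> 'h"
    and \<Phi> :: "nat \<Rightarrow> 'h \<Rightarrow> 'a \<Rightarrow> 'h" and \<xi> :: "'a \<Rightarrow> 'h"
  assumes p: "1 \<le> p" and N: "1 \<le> N" and \<kappa>: "0 \<le> \<kappa>"
    and subalg: "n \<le> N \<Longrightarrow> subalgebra P (F n)"
    and filtration: "n < N \<Longrightarrow> subalgebra (F (Suc n)) (F n)"
    and linear_S: "linear S" and contraction_S: "norm (S x) \<le> norm x"
    and initial: "\<xi> \<in> Lp_functions P (F 0) p"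
    and increment_Lp: "n < N \<Longrightarrow> X \<in> Lp_functions P (F n) p \<Longrightarrow>
      (\<lambda>\<omega>. \<Phi> (Suc n) (X \<omega>) \<omega>) \<in> Lp_functions P (F (Suc n)) p"
    and increment_lipschitz: "n < N \<Longrightarrow>
      AE \<omega> in P. \<forall>x y. norm (\<Phi> (Suc n) x \<omega> - \<Phi> (Suc n) y \<omega>) \<le> \<kappa> * norm (x - y)"
begin

definition grid_space :: "(nat \<Rightarrow> 'a \<Rightarrow> 'h) set" where
  "grid_space = {Z. \<forall>n\<le>N. Z n \<in> Lp_functions P (F n) p}"

definition grid_eq :: "(nat \<Rightarrow> 'a \<Rightarrow> 'h) rel" where
  "grid_eq = {(Y, Z). Y \<in> grid_space \<and> Z \<in> grid_space \<and> (\<forall>n\<le>N. AE \<omega> in P. Y n \<omega> = Z n \<omega>)}"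

definition res :: "(nat \<Rightarrow> 'a \<Rightarrow> 'h) \<Rightarrow> nat \<Rightarrow> 'a \<Rightarrow> 'h" where
  "res Z n = (\<lambda>\<omega>. if n = 0 then Z 0 \<omega> - \<xi> \<omega>
     else Z n \<omega> - S (Z (n - 1) \<omega>) - \<Phi> n (Z (n - 1) \<omega>) \<omega>)"

lemma p_pos: "0 < p"
  using p by simp

lemma grid_spaceD: "Z \<in> grid_space \<Longrightarrow> n \<le> N \<Longrightarrow> Z n \<in> Lp_functions P (F n) p"
  by (simp add: grid_space_def)

lemma S_diff: "S (x - y) = S x - S y"
  using linear_S by (rule linear_diff)

lemma continuous_S: "continuous_on UNIV S"
proof -
  have "bounded_linear S"
    using linear_S contraction_S by (intro bounded_linear_intro[where K = 1]) (auto simp: linear_add linear_scale)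
  then show ?thesis
    by (rule linear_continuous_on)
qed

lemma S_iterate_linear: "linear (S ^^ n)"
proof (induction n)
  case (Suc n)
  then show ?case
    using linear_compose[OF Suc linear_S] by (simp add: o_def)
qed (simp add: linear_id[unfolded id_def] id_def)

lemma S_iterate_contraction: "norm ((S ^^ n) x) \<le> norm x"
  by (induction n) (auto intro: order_trans[OF contraction_S])

lemma step_Lp:
  assumes "n < N" "X \<in> Lp_functions P (F n) p"
  shows "(\<lambda>\<omega>. S (X \<omega>) + \<Phi> (Suc n) (X \<omega>) \<omega>) \<in> Lp_functions P (F (Suc n)) p"
proof (rule Lp_add(1)[OF p])
  show "(\<lambda>\<omega>. S (X \<omega>)) \<in> Lp_functions P (F (Suc n)) p"
    using Lp_functions_lipschitz_image[OF p_pos assms(2) continuous_S contraction_S]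
      Lp_functions_mono[OF filtration[OF assms(1)]] by blast
qed (use assms subalg increment_Lp in auto)

lemma res_in_grid_space: "res \<in> grid_space \<rightarrow> grid_space"
proof
  fix Z assume Z: "Z \<in> grid_space"
  have "res Z n \<in> Lp_functions P (F n) p" if n: "n \<le> N" for n
  proof (cases n)
    case 0
    then show ?thesis
      using Lp_diff[OF p subalg[of 0] grid_spaceD[OF Z, of 0] initial] by (simp add: res_def)
  next
    case (Suc m)
    then have "(\<lambda>\<omega>. Z n \<omega> - (S (Z m \<omega>) + \<Phi> n (Z m \<omega>) \<omega>)) \<in> Lp_functions P (F n) p"
      using n step_Lp[of m "Z m"] by (intro Lp_diff[OF p subalg[OF n] grid_spaceD[OF Z n]]) (simp add: grid_spaceD[OF Z])
    then show ?thesis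
      by (simp add: res_def Suc diff_diff_eq)
  qed
  then show "res Z \<in> grid_space"
    by (simp add: grid_space_def)
qed

text \<open>
  The method is explicit: given the residual at step \<open>n\<close> and the value at step \<open>n - 1\<close>, the value at step
  \<open>n\<close> can be read off, and \<open>step_Lp\<close> keeps it in the right space.
\<close>

lemma res_surj:
  assumes R: "R \<in> grid_space"
  shows "\<exists>Z\<in>grid_space. res Z = R"
proof -
  define Z where "Z = rec_nat (\<lambda>\<omega>. R 0 \<omega> + \<xi> \<omega>)
    (\<lambda>n X \<omega>. R (Suc n) \<omega> + (S (X \<omega>) + \<Phi> (Suc n) (X \<omega>) \<omega>))"
  have Z_0: "Z 0 = (\<lambda>\<omega>. R 0 \<omega> + \<xi> \<omega>)"
    and Z_Suc: "Z (Suc n) = (\<lambda>\<omega>. R (Suc n) \<omega> + (S (Z n \<omega>) + \<Phi> (Suc n) (Z n \<omega>) \<omega>))" for n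
    by (simp_all add: Z_def)
  have "Z n \<in> Lp_functions P (F n) p" if "n \<le> N" for n
    using that
  proof (induction n)
    case 0
    then show ?case
      unfolding Z_0 using Lp_add(1)[OF p subalg grid_spaceD[OF R] initial] by simp
  next
    case (Suc n)
    then show ?case
      unfolding Z_Suc by (intro Lp_add(1)[OF p subalg grid_spaceD[OF R] step_Lp]) auto
  qed
  then have "Z \<in> grid_space"
    by (simp add: grid_space_def)
  moreover have "res Z n = R n" for n
    by (cases n) (auto simp: res_def Z_0 Z_Suc)
  ultimately show ?thesis
    by blast
qed

lemma equiv_grid_eq: "equiv grid_space grid_eq"
proof (rule equivI)
  show "trans grid_eq"
    unfolding grid_eq_def by (rule transI) force
qed (auto simp: grid_eq_def refl_on_def sym_def eq_commute)

text \<open>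
  Going forward in time, the residuals and the value at step \<open>n - 1\<close> determine the value at step \<open>n\<close>,
  so two grid functions coincide almost surely exactly if their residuals do.
\<close>

lemma res_eq_iff:
  assumes Y: "Y \<in> grid_space" and Z: "Z \<in> grid_space"
  shows "(res Y, res Z) \<in> grid_eq \<longleftrightarrow> (Y, Z) \<in> grid_eq"
proof -
  have "(\<forall>n\<le>N. AE \<omega> in P. res Y n \<omega> = res Z n \<omega>) \<longleftrightarrow> (\<forall>n\<le>N. AE \<omega> in P. Y n \<omega> = Z n \<omega>)"
    (is "?l \<longleftrightarrow> ?r")
  proof
    assume l: ?l
    have "AE \<omega> in P. Y n \<omega> = Z n \<omega>" if "n \<le> N" for n
      using that
    proof (induction n)
      case 0
      then show ?case
        using l[rule_format, of 0] by (auto simp: res_def)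
    next
      case (Suc n)
      then have "AE \<omega> in P. Y n \<omega> = Z n \<omega>" "AE \<omega> in P. res Y (Suc n) \<omega> = res Z (Suc n) \<omega>"
        using l by auto
      then show ?case
        by eventually_elim (auto simp: res_def)
    qed
    then show ?r by blast
  next
    assume r: ?r
    have "AE \<omega> in P. res Y n \<omega> = res Z n \<omega>" if "n \<le> N" for n
    proof -
      have "AE \<omega> in P. Y n \<omega> = Z n \<omega>" "AE \<omega> in P. Y (n - 1) \<omega> = Z (n - 1) \<omega>"
        using r that by auto
      then show ?thesis
        by eventually_elim (auto simp: res_def)
    qed
    then show ?l by blast
  qed
  then show ?thesis
    using Y Z res_in_grid_space by (auto simp: grid_eq_def)
qed

lemma bijective:
  "(\<lambda>Z. grid_eq `` {res Z}) respects grid_eq"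
  "bij_betw (\<lambda>c. \<Union>Z\<in>c. grid_eq `` {res Z}) (grid_space // grid_eq) (grid_space // grid_eq)"
proof -
  have "\<exists>Z\<in>grid_space. (res Z, Y) \<in> grid_eq" if "Y \<in> grid_space" for Y
    using res_surj[OF that] equiv_grid_eq that by (auto simp: equiv_def refl_on_def)
  then show "(\<lambda>Z. grid_eq `` {res Z}) respects grid_eq"
    "bij_betw (\<lambda>c. \<Union>Z\<in>c. grid_eq `` {res Z}) (grid_space // grid_eq) (grid_space // grid_eq)"
    using bij_betw_quotient[OF equiv_grid_eq res_in_grid_space res_eq_iff] by blast+
qed

text \<open>
  The discrete variation-of-constants formula. It shows why the stability norm contains the sums of
  \<open>S\<^sup>n\<^sup>-\<^sup>j\<close> applied to the residuals: up to the initial difference, these sums and the difference of the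
  grid functions only differ by differences of increments, which have the small Lipschitz constant \<open>\<kappa>\<close>.
\<close>

lemma variation_of_constants:
  defines "D \<equiv> \<lambda>Y Z n \<omega>. \<Sum>j=1..n. (S ^^ (n - j)) (res Y j \<omega> - res Z j \<omega>)"
  shows "Y n \<omega> - Z n \<omega> = (S ^^ n) (Y 0 \<omega> - Z 0 \<omega>) + D Y Z n \<omega>
    + (\<Sum>j<n. (S ^^ (n - Suc j)) (\<Phi> (Suc j) (Y j \<omega>) \<omega> - \<Phi> (Suc j) (Z j \<omega>) \<omega>))"
proof (induction n)
  case (Suc n)
  have S: "S (\<Sum>i\<in>I. (S ^^ a i) (X i)) = (\<Sum>i\<in>I. (S ^^ Suc (a i)) (X i))" for I :: "nat set" and a X
    by (simp add: linear_sum[OF linear_S])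
  have D: "D Y Z (Suc n) \<omega> = S (D Y Z n \<omega>) + (res Y (Suc n) \<omega> - res Z (Suc n) \<omega>)"
    by (simp add: D_def S Suc_diff_le del: funpow.simps)
  have \<Phi>: "(\<Sum>j<Suc n. (S ^^ (Suc n - Suc j)) (\<Phi> (Suc j) (Y j \<omega>) \<omega> - \<Phi> (Suc j) (Z j \<omega>) \<omega>))
      = S (\<Sum>j<n. (S ^^ (n - Suc j)) (\<Phi> (Suc j) (Y j \<omega>) \<omega> - \<Phi> (Suc j) (Z j \<omega>) \<omega>))
        + (\<Phi> (Suc n) (Y n \<omega>) \<omega> - \<Phi> (Suc n) (Z n \<omega>) \<omega>)"
    by (simp add: S Suc_diff_Suc del: funpow.simps)
  have "Y (Suc n) \<omega> - Z (Suc n) \<omega> = S (Y n \<omega> - Z n \<omega>) + (res Y (Suc n) \<omega> - res Z (Suc n) \<omega>)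
      + (\<Phi> (Suc n) (Y n \<omega>) \<omega> - \<Phi> (Suc n) (Z n \<omega>) \<omega>)"
    by (simp add: res_def S_diff)
  then show ?case
    unfolding Suc.IH D \<Phi> by (simp add: linear_add[OF linear_S])
qed (simp add: D_def)

lemma increment_difference_bound:
  assumes "\<forall>j<N. \<forall>x y. norm (\<Phi> (Suc j) x \<omega> - \<Phi> (Suc j) y \<omega>) \<le> \<kappa> * norm (x - y)" "n \<le> N"
  shows "norm (\<Sum>j<n. (S ^^ (n - Suc j)) (\<Phi> (Suc j) (Y j \<omega>) \<omega> - \<Phi> (Suc j) (Z j \<omega>) \<omega>))
    \<le> \<kappa> * (\<Sum>j<n. norm (Y j \<omega> - Z j \<omega>))"
  unfolding sum_distrib_left
proof (rule sum_norm_le)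
  fix j assume "j \<in> {..<n}"
  then show "norm ((S ^^ (n - Suc j)) (\<Phi> (Suc j) (Y j \<omega>) \<omega> - \<Phi> (Suc j) (Z j \<omega>) \<omega>)) \<le> \<kappa> * norm (Y j \<omega> - Z j \<omega>)"
    using assms by (intro order_trans[OF S_iterate_contraction]) (simp del: funpow.simps)
qed

lemma AE_increment_lipschitz:
  "AE \<omega> in P. \<forall>j<N. \<forall>x y. norm (\<Phi> (Suc j) x \<omega> - \<Phi> (Suc j) y \<omega>) \<le> \<kappa> * norm (x - y)"
proof -
  have "AE \<omega> in P. \<forall>j\<in>{..<N}. \<forall>x y. norm (\<Phi> (Suc j) x \<omega> - \<Phi> (Suc j) y \<omega>) \<le> \<kappa> * norm (x - y)"
    using increment_lipschitz by (intro AE_finite_allI) auto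
  then show ?thesis
    by (rule eventually_mono) simp
qed

definition norm_inf :: "(nat \<Rightarrow> 'a \<Rightarrow> 'h) \<Rightarrow> real" where
  "norm_inf Z = (MAX n\<in>{0..N}. Lp_norm P p (Z n))"

definition norm_S :: "(nat \<Rightarrow> 'a \<Rightarrow> 'h) \<Rightarrow> real" where
  "norm_S Z = Lp_norm P p (Z 0) +
     (MAX n\<in>{1..N}. Lp_norm P p (\<lambda>\<omega>. \<Sum>j=1..n. (S ^^ (n - j)) (Z j \<omega>)))"

lemma Lp_iterated_sum:
  assumes Z: "Z \<in> grid_space" and n: "n \<le> N"
  shows "(\<lambda>\<omega>. \<Sum>j=1..n. (S ^^ (n - j)) (Z j \<omega>)) \<in> Lp_functions P P p"
proof -
  have P: "subalgebra P P"
    by (simp add: subalgebra_def)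
  have "(\<lambda>\<omega>. (S ^^ (n - j)) (Z j \<omega>)) \<in> Lp_functions P P p" if "j \<in> {1..n}" for j
  proof (rule Lp_functions_lipschitz_image[where X = "Z j" and G = "S ^^ (n - j)", OF p_pos])
    show "Z j \<in> Lp_functions P P p"
      using Lp_functions_mono[OF subalg[of j]] grid_spaceD[OF Z, of j] that n by auto
    have "bounded_linear (S ^^ (n - j))"
      using S_iterate_linear[of "n - j"] S_iterate_contraction
      by (intro bounded_linear_intro[where K = 1]) (auto simp: linear_add linear_scale)
    then show "continuous_on UNIV (S ^^ (n - j))"
      by (rule linear_continuous_on)
  qed (rule S_iterate_contraction)
  then show ?thesis
    by (rule Lp_sum[OF p P, THEN conjunct1])
qed

lemma diff_in_grid_space:
  assumes "Y \<in> grid_space" "Z \<in> grid_space"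
  shows "Y - Z \<in> grid_space"
proof -
  have "(Y - Z) n \<in> Lp_functions P (F n) p" if "n \<le> N" for n
    using Lp_diff[OF p subalg[OF that] grid_spaceD[OF assms(1) that] grid_spaceD[OF assms(2) that]]
    by (simp add: fun_diff_def)
  then show ?thesis
    by (simp add: grid_space_def)
qed

lemma Lp_norm_le_norm_inf: "n \<le> N \<Longrightarrow> Lp_norm P p (Z n) \<le> norm_inf Z"
  unfolding norm_inf_def by (rule Max_ge) auto

text \<open>
  Minkowski's inequality turns a pathwise bound by finitely many grid values into a bound of norms.
\<close>

lemma Lp_norm_le_weighted_sum:
  assumes X: "X \<in> Lp_functions P P p" and Z: "Z \<in> grid_space" and n: "n \<le> N" and m: "m \<le> N"
    and bound: "AE \<omega> in P. norm (Y \<omega>) \<le> norm (X \<omega>) + norm (Z m \<omega>) + \<kappa> * (\<Sum>j<n. norm (Z j \<omega>))"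
  shows "Lp_norm P p Y \<le> Lp_norm P p X + Lp_norm P p (Z m) + \<kappa> * (\<Sum>j<n. Lp_norm P p (Z j))"
proof -
  have P: "subalgebra P P"
    by (simp add: subalgebra_def)
  have Z': "(\<lambda>\<omega>. norm (Z j \<omega>)) \<in> Lp_functions P P p" if "j \<le> N" for j
    using Lp_functions_mono[OF subalg[OF that]] Lp_functions_norm[OF grid_spaceD[OF Z that]] by blast
  let ?s = "\<lambda>\<omega>. \<Sum>j<n. norm (Z j \<omega>)"
  have s: "?s \<in> Lp_functions P P p" "Lp_norm P p ?s \<le> (\<Sum>j<n. Lp_norm P p (Z j))"
    using Lp_sum[OF p P, of "{..<n}" "\<lambda>j \<omega>. norm (Z j \<omega>)"] Z' n by (auto simp: Lp_norm_norm)
  note \<kappa>s = Lp_scaleR[OF p P s(1), of \<kappa>]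
  note XZ = Lp_add[OF p P Lp_functions_norm[OF X] Z'[OF m]]
  note all = Lp_add[OF p P XZ(1) \<kappa>s(1)]
  have "Lp_norm P p Y \<le> Lp_norm P p (\<lambda>\<omega>. norm (X \<omega>) + norm (Z m \<omega>) + \<kappa> *\<^sub>R ?s \<omega>)"
    using bound by (intro Lp_norm_mono_AE[OF p_pos all(1)]) auto
  also have "\<dots> \<le> Lp_norm P p X + Lp_norm P p (Z m) + \<kappa> * Lp_norm P p ?s"
    using all(2) XZ(2) \<kappa>s(2) \<kappa> by (simp add: Lp_norm_norm)
  also have "\<dots> \<le> Lp_norm P p X + Lp_norm P p (Z m) + \<kappa> * (\<Sum>j<n. Lp_norm P p (Z j))"
    using s(2) \<kappa> by (intro add_left_mono mult_left_mono)
  finally show ?thesis .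
qed

text \<open>
  The variation-of-constants formula solved for the sum of residuals: the two differences of grid
  values and the increments contribute \<open>2 + N \<kappa>\<close>, the initial residual contributes another 1.
\<close>

lemma norm_S_le_norm_inf:
  assumes Y: "Y \<in> grid_space" and Z: "Z \<in> grid_space"
  shows "norm_S (res Y - res Z) \<le> (3 + real N * \<kappa>) * norm_inf (Y - Z)"
proof -
  let ?E = "Y - Z" and ?D = "res Y - res Z"
  have E: "?E \<in> grid_space"
    using diff_in_grid_space[OF Y Z] .
  have P: "?E j \<in> Lp_functions P P p" if "j \<le> N" for j
    using Lp_functions_mono[OF subalg[OF that]] grid_spaceD[OF E that] by blast
  have "Lp_norm P p (\<lambda>\<omega>. \<Sum>j=1..n. (S ^^ (n - j)) (?D j \<omega>)) \<le> (2 + real N * \<kappa>) * norm_inf ?E"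
    if n: "n \<le> N" for n
  proof -
    have "Lp_norm P p (\<lambda>\<omega>. \<Sum>j=1..n. (S ^^ (n - j)) (?D j \<omega>))
        \<le> Lp_norm P p (?E n) + Lp_norm P p (?E 0) + \<kappa> * (\<Sum>j<n. Lp_norm P p (?E j))"
    proof (rule Lp_norm_le_weighted_sum[OF P[OF n] E n])
      show "AE \<omega> in P. norm (\<Sum>j=1..n. (S ^^ (n - j)) (?D j \<omega>))
          \<le> norm (?E n \<omega>) + norm (?E 0 \<omega>) + \<kappa> * (\<Sum>j<n. norm (?E j \<omega>))"
        using AE_increment_lipschitz
      proof eventually_elim
        case (elim \<omega>)
        let ?s = "\<Sum>j<n. (S ^^ (n - Suc j)) (\<Phi> (Suc j) (Y j \<omega>) \<omega> - \<Phi> (Suc j) (Z j \<omega>) \<omega>)"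
        have "(\<Sum>j=1..n. (S ^^ (n - j)) (?D j \<omega>)) = ?E n \<omega> - (S ^^ n) (?E 0 \<omega>) - ?s"
          using variation_of_constants[of Y n \<omega> Z] by (simp add: algebra_simps)
        then have "norm (\<Sum>j=1..n. (S ^^ (n - j)) (?D j \<omega>))
            \<le> norm (?E n \<omega>) + norm ((S ^^ n) (?E 0 \<omega>)) + norm ?s"
          using norm_triangle_ineq4[of "?E n \<omega> - (S ^^ n) (?E 0 \<omega>)" ?s]
            norm_triangle_ineq4[of "?E n \<omega>" "(S ^^ n) (?E 0 \<omega>)"] by simp
        then show ?case
          using S_iterate_contraction[of n "?E 0 \<omega>"] increment_difference_bound[OF elim n, of Y Z]
          by simp
      qed
    qed simp
    also have "\<dots> \<le> norm_inf ?E + norm_inf ?E + \<kappa> * (\<Sum>j<n. norm_inf ?E)"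
      using n \<kappa> by (intro add_mono mult_left_mono sum_mono Lp_norm_le_norm_inf) auto
    also have "\<dots> = (2 + real n * \<kappa>) * norm_inf ?E"
      by (simp add: algebra_simps)
    also have "\<dots> \<le> (2 + real N * \<kappa>) * norm_inf ?E"
      using n \<kappa> Lp_norm_le_norm_inf[of 0 ?E] Lp_norm_nonneg[of P p "?E 0"]
      by (intro mult_right_mono) (auto intro: mult_right_mono)
    finally show ?thesis .
  qed
  then have "(MAX n\<in>{1..N}. Lp_norm P p (\<lambda>\<omega>. \<Sum>j=1..n. (S ^^ (n - j)) (?D j \<omega>)))
      \<le> (2 + real N * \<kappa>) * norm_inf ?E"
    using N by (subst Max_le_iff) auto
  moreover have "Lp_norm P p (?D 0) = Lp_norm P p (?E 0)"
    by (rule arg_cong[where f = "Lp_norm P p"]) (auto simp: res_def)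
  ultimately show ?thesis
    using Lp_norm_le_norm_inf[of 0 ?E] unfolding norm_S_def by (simp add: algebra_simps)
qed

text \<open>
  The variation-of-constants formula solved for the difference at step \<open>n\<close>, which is then bounded by
  the residuals and the earlier differences, so that Gronwall's inequality applies.
\<close>

lemma norm_inf_le_norm_S:
  assumes Y: "Y \<in> grid_space" and Z: "Z \<in> grid_space"
  shows "norm_inf (Y - Z) \<le> exp (real N * \<kappa>) * norm_S (res Y - res Z)"
proof -
  let ?E = "Y - Z" and ?D = "res Y - res Z"
  let ?d = "\<lambda>n \<omega>. \<Sum>j=1..n. (S ^^ (n - j)) (?D j \<omega>)"
  have E: "?E \<in> grid_space"
    using diff_in_grid_space[OF Y Z] .
  have D: "?D \<in> grid_space"
    using diff_in_grid_space res_in_grid_space Y Z by blast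
  have D0: "Lp_norm P p (?D 0) = Lp_norm P p (?E 0)"
    by (rule arg_cong[where f = "Lp_norm P p"]) (auto simp: res_def)
  have d_le: "Lp_norm P p (?E 0) + Lp_norm P p (?d n) \<le> norm_S ?D" if "1 \<le> n" "n \<le> N" for n
    unfolding norm_S_def D0 using that by (intro add_left_mono Max_ge) auto
  have S0: "0 \<le> norm_S ?D"
    using d_le[of 1] N Lp_norm_nonneg[of P p "?E 0"] Lp_norm_nonneg[of P p "?d 1"] by linarith
  have recursion: "Lp_norm P p (?E n) \<le> norm_S ?D + \<kappa> * (\<Sum>j<n. Lp_norm P p (?E j))" if n: "n \<le> N" for n
  proof (cases "n = 0")
    case True
    then show ?thesis
      using d_le[of 1] N Lp_norm_nonneg[of P p "?d 1"] by simp
  next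
    case False
    have "Lp_norm P p (?E n) \<le> Lp_norm P p (?d n) + Lp_norm P p (?E 0) + \<kappa> * (\<Sum>j<n. Lp_norm P p (?E j))"
    proof (rule Lp_norm_le_weighted_sum[OF Lp_iterated_sum[OF D n] E n])
      show "AE \<omega> in P. norm (?E n \<omega>) \<le> norm (?d n \<omega>) + norm (?E 0 \<omega>) + \<kappa> * (\<Sum>j<n. norm (?E j \<omega>))"
        using AE_increment_lipschitz
      proof eventually_elim
        case (elim \<omega>)
        let ?s = "\<Sum>j<n. (S ^^ (n - Suc j)) (\<Phi> (Suc j) (Y j \<omega>) \<omega> - \<Phi> (Suc j) (Z j \<omega>) \<omega>)"
        have "?E n \<omega> = (S ^^ n) (?E 0 \<omega>) + ?d n \<omega> + ?s"
          using variation_of_constants[of Y n \<omega> Z] by simp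
        then have "norm (?E n \<omega>) \<le> norm ((S ^^ n) (?E 0 \<omega>)) + norm (?d n \<omega>) + norm ?s"
          using norm_triangle_ineq[of "(S ^^ n) (?E 0 \<omega>) + ?d n \<omega>" ?s]
            norm_triangle_ineq[of "(S ^^ n) (?E 0 \<omega>)" "?d n \<omega>"] by simp
        then show ?case
          using S_iterate_contraction[of n "?E 0 \<omega>"] increment_difference_bound[OF elim n, of Y Z]
          by simp
      qed
    qed simp
    then show ?thesis
      using d_le[of n] False n by simp
  qed
  have "Lp_norm P p (?E n) \<le> exp (real N * \<kappa>) * norm_S ?D" if n: "n \<le> N" for n
  proof -
    have "Lp_norm P p (?E n) \<le> norm_S ?D * (1 + \<kappa>) ^ n"
      by (rule discrete_gronwall[OF \<kappa> S0 recursion n])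
    also have "\<dots> \<le> norm_S ?D * (1 + \<kappa>) ^ N"
      using \<kappa> n S0 by (intro mult_left_mono power_increasing) auto
    also have "\<dots> \<le> norm_S ?D * exp \<kappa> ^ N"
      using \<kappa> S0 by (intro mult_left_mono power_mono exp_ge_add_one_self) auto
    also have "\<dots> = exp (real N * \<kappa>) * norm_S ?D"
      unfolding exp_of_nat_mult by (rule mult.commute)
    finally show ?thesis .
  qed
  then show ?thesis
    unfolding norm_inf_def by (subst Max_le_iff) auto
qed

end

section \<open>Expansions in orthonormal bases\<close>

definition partial_expansion :: "(nat \<Rightarrow> 'a::real_inner) \<Rightarrow> nat \<Rightarrow> 'a \<Rightarrow> 'a" where
  "partial_expansion e n x = (\<Sum>j<n. (x \<bullet> e j) *\<^sub>R e j)"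

lemma orthonormal_basis_inner:
  "orthonormal_basis e \<Longrightarrow> e i \<bullet> e j = (if i = j then 1 else 0)"
  by (simp add: orthonormal_basis_def)

lemma norm_power2_orthonormal_sum:
  assumes "orthonormal_basis e"
  shows "(norm (\<Sum>j<n. c j *\<^sub>R e j))\<^sup>2 = (\<Sum>j<n::nat. (c j)\<^sup>2)"
  unfolding power2_norm_eq_inner
  by (simp add: inner_sum_left inner_sum_right orthonormal_basis_inner[OF assms] power2_eq_square
      if_distrib[of "(*) _"] cong: if_cong)

lemma linear_partial_expansion: "linear (partial_expansion e n)"
  by (rule linearI) (simp_all add: partial_expansion_def inner_add_left scaleR_add_left sum.distrib
      scaleR_sum_right)

lemma norm_partial_expansion_le:
  assumes "orthonormal_basis e"
  shows "norm (partial_expansion e n x) \<le> norm x"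
proof -
  have "(norm (partial_expansion e n x))\<^sup>2 = (\<Sum>j<n. (x \<bullet> e j)\<^sup>2)"
    by (simp add: partial_expansion_def norm_power2_orthonormal_sum[OF assms])
  also have "\<dots> = x \<bullet> partial_expansion e n x"
    by (simp add: partial_expansion_def inner_sum_right power2_eq_square)
  also have "\<dots> \<le> norm x * norm (partial_expansion e n x)"
    by (rule norm_cauchy_schwarz)
  finally show ?thesis
    by (cases "norm (partial_expansion e n x) = 0") (auto simp: power2_eq_square)
qed

lemma partial_expansion_eventually_id:
  assumes e: "orthonormal_basis e" and x: "x \<in> span (range e)"
  shows "eventually (\<lambda>n. partial_expansion e n x = x) sequentially"
  using x
proof (induction rule: span_induct_alt)
  case base
  then show ?case
    by (simp add: partial_expansion_def)
next
  case (step c v y)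
  then obtain i where v: "v = e i"
    by blast
  have "eventually (\<lambda>n. partial_expansion e n v = v) sequentially"
    using eventually_gt_at_top[of i]
  proof eventually_elim
    case (elim n)
    then show ?case
      by (simp add: v partial_expansion_def orthonormal_basis_inner[OF e] if_distrib[of "\<lambda>c. c *\<^sub>R _"]
          cong: if_cong)
  qed
  with step.IH show ?case
    by eventually_elim (simp add: linear_add[OF linear_partial_expansion] linear_scale[OF linear_partial_expansion])
qed

text \<open>
  Partial expansions are uniformly bounded and eventually reproduce the elements of the span of the
  basis, which is dense.
\<close>

lemma partial_expansion_tendsto:
  assumes e: "orthonormal_basis e"
  shows "(\<lambda>n. partial_expansion e n x) \<longlonglongrightarrow> x"
proof (rule tendstoI)
  fix \<epsilon> :: real assume "0 < \<epsilon>"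
  have "x \<in> closure (span (range e))"
    using e by (simp add: orthonormal_basis_def)
  then obtain v where v: "v \<in> span (range e)" "dist v x < \<epsilon> / 2"
    unfolding closure_approachable using \<open>0 < \<epsilon>\<close> by (meson half_gt_zero)
  show "eventually (\<lambda>n. dist (partial_expansion e n x) x < \<epsilon>) sequentially"
    using partial_expansion_eventually_id[OF e v(1)]
  proof eventually_elim
    case (elim n)
    have "partial_expansion e n x - x = partial_expansion e n (x - v) + (v - x)"
      by (simp add: elim linear_diff[OF linear_partial_expansion])
    then have "dist (partial_expansion e n x) x \<le> norm (partial_expansion e n (x - v)) + norm (v - x)"
      by (metis dist_norm norm_triangle_ineq)
    then show ?case
      using norm_partial_expansion_le[OF e, of n "x - v"] v(2) by (simp add: dist_norm norm_minus_commute)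
  qed
qed

text \<open>
  Powers of an operator whose spectrum is bounded away from 0 control the norm. The inequality
  holds for the partial sums by comparing coefficients, and passes to the limit.
\<close>

lemma norm_le_dotH_norm:
  fixes x :: "'a::real_inner"
  assumes e: "orthonormal_basis e" and lam: "\<And>j. 0 < lam j" "incseq lam"
    and r: "0 \<le> r" and x: "x \<in> dotH lam e r"
  shows "norm x \<le> lam 0 powr (- r / 2) * dotH_norm lam e r x"
proof -
  let ?y = "\<lambda>n. \<Sum>j<n. (lam j powr (r / 2) * (x \<bullet> e j)) *\<^sub>R e j"
  have "norm (partial_expansion e n x) \<le> lam 0 powr (- r / 2) * norm (?y n)" for n
  proof (rule power2_le_imp_le)
    have "(norm (partial_expansion e n x))\<^sup>2 = (\<Sum>j<n. (x \<bullet> e j)\<^sup>2)"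
      by (simp add: partial_expansion_def norm_power2_orthonormal_sum[OF e])
    also have "\<dots> \<le> (\<Sum>j<n. (lam 0 powr (- r / 2))\<^sup>2 * (lam j powr (r / 2) * (x \<bullet> e j))\<^sup>2)"
    proof (rule sum_mono)
      fix j
      have "lam 0 powr (r / 2) \<le> lam j powr (r / 2)"
        using r lam(1)[of 0] incseqD[OF lam(2), of 0 j] by (intro powr_mono2) auto
      then have "1 \<le> lam 0 powr (- r / 2) * lam j powr (r / 2)"
        using lam(1)[of 0] by (simp add: powr_minus field_simps)
      then have "1 * (x \<bullet> e j)\<^sup>2 \<le> (lam 0 powr (- r / 2) * lam j powr (r / 2))\<^sup>2 * (x \<bullet> e j)\<^sup>2"
        by (intro mult_right_mono one_le_power) auto
      then show "(x \<bullet> e j)\<^sup>2 \<le> (lam 0 powr (- r / 2))\<^sup>2 * (lam j powr (r / 2) * (x \<bullet> e j))\<^sup>2"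
        by (simp add: power_mult_distrib mult.assoc)
    qed
    also have "\<dots> = (lam 0 powr (- r / 2) * norm (?y n))\<^sup>2"
      by (simp add: norm_power2_orthonormal_sum[OF e] power_mult_distrib sum_distrib_left)
    finally show "(norm (partial_expansion e n x))\<^sup>2 \<le> (lam 0 powr (- r / 2) * norm (?y n))\<^sup>2" .
  qed simp
  moreover have "(\<lambda>n. norm (partial_expansion e n x)) \<longlonglongrightarrow> norm x"
    by (intro tendsto_norm partial_expansion_tendsto e)
  moreover have "(\<lambda>n. lam 0 powr (- r / 2) * norm (?y n)) \<longlonglongrightarrow> lam 0 powr (- r / 2) * dotH_norm lam e r x"
    using x unfolding dotH_norm_def op_pow_def dotH_def
    by (intro tendsto_mult tendsto_const tendsto_norm) (auto simp: summable_LIMSEQ)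
  ultimately show ?thesis
    by (intro LIMSEQ_le) auto
qed

lemma op_pow_add:
  assumes "x \<in> dotH lam e r" "y \<in> dotH lam e r"
  shows "op_pow lam e (r / 2) (x + y) = op_pow lam e (r / 2) x + op_pow lam e (r / 2) y"
  using assms by (simp add: op_pow_def dotH_def inner_add_left distrib_left scaleR_add_left suminf_add)

lemma op_pow_scaleR:
  assumes "x \<in> dotH lam e r"
  shows "op_pow lam e (r / 2) (c *\<^sub>R x) = c *\<^sub>R op_pow lam e (r / 2) x"
  using assms suminf_scaleR_right[of "\<lambda>j. (lam j powr (r / 2) * (x \<bullet> e j)) *\<^sub>R e j" c]
  by (simp add: op_pow_def dotH_def mult.left_commute)

section \<open>Galerkin projections and resolvents\<close>

lemma orthonormal_spanning_set:
  fixes B :: "'a::real_inner set"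
  assumes "finite B"
  shows "\<exists>C. finite C \<and> span C = span B \<and> (\<forall>c\<in>C. \<forall>d\<in>C. c \<bullet> d = (if c = d then 1 else 0))"
proof -
  obtain C where C: "finite C" "span C = span B" "pairwise orthogonal C"
    using basis_orthogonal[OF assms] by blast
  define D where "D = (\<lambda>c. (1 / norm c) *\<^sub>R c) ` (C - {0})"
  have "span D = span B"
    unfolding D_def using C by (subst span_image_scale) auto
  moreover have "c \<bullet> d = (if c = d then 1 else 0)" if cd: "c \<in> D" "d \<in> D" for c d
  proof -
    obtain a b where ab: "a \<in> C" "a \<noteq> 0" "c = (1 / norm a) *\<^sub>R a" "b \<in> C" "b \<noteq> 0" "d = (1 / norm b) *\<^sub>R b"
      using cd by (auto simp: D_def)
    have self: "c \<bullet> c = 1"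
      using ab by (simp add: dot_square_norm power2_eq_square)
    have "a \<noteq> b \<Longrightarrow> c \<bullet> d = 0"
      using C(3) ab by (auto simp: pairwise_def orthogonal_def)
    moreover have "a = b \<Longrightarrow> c = d"
      using ab by simp
    ultimately show ?thesis
      using self by (cases "a = b") auto
  qed
  ultimately show ?thesis
    using C(1) by (intro exI[of _ D]) (auto simp: D_def)
qed

locale galerkin_space =
  fixes lam :: "nat \<Rightarrow> real" and e :: "nat \<Rightarrow> 'h::real_inner" and Vh :: "'h set"
  assumes subspace_Vh: "subspace Vh" and Vh_dotH: "Vh \<subseteq> dotH lam e 1"
    and finite_dim: "\<exists>B. finite B \<and> Vh = span B"
begin

definition basis :: "'h set" where
  "basis = (SOME C. finite C \<and> span C = Vh \<and> (\<forall>c\<in>C. \<forall>d\<in>C. c \<bullet> d = (if c = d then 1 else 0)))"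

lemma basis:
  shows finite_basis: "finite basis" and span_basis: "span basis = Vh"
    and inner_basis: "\<And>c d. c \<in> basis \<Longrightarrow> d \<in> basis \<Longrightarrow> c \<bullet> d = (if c = d then 1 else 0)"
proof -
  have "\<exists>C. finite C \<and> span C = Vh \<and> (\<forall>c\<in>C. \<forall>d\<in>C. c \<bullet> d = (if c = d then 1 else 0))"
    using finite_dim orthonormal_spanning_set by metis
  from someI_ex[OF this] show "finite basis" "span basis = Vh"
    "\<And>c d. c \<in> basis \<Longrightarrow> d \<in> basis \<Longrightarrow> c \<bullet> d = (if c = d then 1 else 0)"
    unfolding basis_def[symmetric] by blast+
qed

lemma basis_in_Vh: "c \<in> basis \<Longrightarrow> c \<in> Vh"
  using span_basis span_base by blast

lemma eq_0_if_orthogonal: "y \<in> Vh \<Longrightarrow> (\<And>z. z \<in> Vh \<Longrightarrow> y \<bullet> z = 0) \<Longrightarrow> y = 0"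
  using inner_eq_zero_iff by blast

lemma basis_sum_in_Vh: "(\<Sum>c\<in>basis. a c *\<^sub>R c) \<in> Vh"
  by (intro subspace_sum subspace_Vh subspace_scale basis_in_Vh)

lemma inner_basis_sum:
  assumes "d \<in> basis"
  shows "(\<Sum>c\<in>basis. a c *\<^sub>R c) \<bullet> d = a d"
proof -
  have "(\<Sum>c\<in>basis. a c *\<^sub>R c) \<bullet> d = (\<Sum>c\<in>basis. if c = d then a c else 0)"
    unfolding inner_sum_left using assms by (intro sum.cong) (auto simp: inner_basis)
  then show ?thesis
    using assms by (simp add: finite_basis)
qed

lemma orthogonal_Vh:
  assumes "\<And>c. c \<in> basis \<Longrightarrow> y \<bullet> c = 0" "z \<in> Vh"
  shows "y \<bullet> z = 0"
proof -
  have "z \<in> span basis"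
    using assms(2) by (simp add: span_basis)
  then show ?thesis
    by (induction rule: span_induct_alt) (auto simp: inner_add_right assms(1))
qed

lemma basis_expansion:
  assumes "x \<in> Vh"
  shows "(\<Sum>c\<in>basis. (x \<bullet> c) *\<^sub>R c) = x"
proof -
  let ?y = "(\<Sum>c\<in>basis. (x \<bullet> c) *\<^sub>R c) - x"
  have "?y = 0"
  proof (rule eq_0_if_orthogonal)
    show "?y \<in> Vh"
      using assms by (intro subspace_diff subspace_Vh basis_sum_in_Vh)
    show "?y \<bullet> z = 0" if "z \<in> Vh" for z
      using that by (rule orthogonal_Vh[rotated]) (simp add: inner_diff_left inner_basis_sum)
  qed
  then show ?thesis by simp
qed

lemma orth_proj_eqI:
  assumes "y \<in> Vh" "\<And>z. z \<in> Vh \<Longrightarrow> (x - y) \<bullet> z = 0"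
  shows "orth_proj Vh x = y"
  unfolding orth_proj_def
proof (rule the_equality)
  fix w assume w: "w \<in> Vh \<and> (\<forall>z\<in>Vh. (x - w) \<bullet> z = 0)"
  have "w - y = 0"
  proof (rule eq_0_if_orthogonal)
    fix z assume "z \<in> Vh"
    then show "(w - y) \<bullet> z = 0"
      using assms(2)[of z] w by (auto simp: inner_diff_left)
  qed (use w assms(1) subspace_Vh in \<open>auto intro: subspace_diff\<close>)
  then show "w = y" by simp
qed (use assms in auto)

lemma orth_proj_eq: "orth_proj Vh x = (\<Sum>c\<in>basis. (x \<bullet> c) *\<^sub>R c)"
proof (rule orth_proj_eqI[OF basis_sum_in_Vh])
  fix z assume "z \<in> Vh"
  then show "(x - (\<Sum>c\<in>basis. (x \<bullet> c) *\<^sub>R c)) \<bullet> z = 0"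
    by (rule orthogonal_Vh[rotated]) (simp add: inner_diff_left inner_basis_sum)
qed

lemma orth_proj_in_Vh: "orth_proj Vh x \<in> Vh"
  by (simp add: orth_proj_eq basis_sum_in_Vh)

lemma inner_orth_proj: "z \<in> Vh \<Longrightarrow> orth_proj Vh x \<bullet> z = x \<bullet> z"
  using orthogonal_Vh[of "x - orth_proj Vh x" z]
  by (simp add: orth_proj_eq inner_diff_left inner_basis_sum)

lemma orth_proj_id: "x \<in> Vh \<Longrightarrow> orth_proj Vh x = x"
  by (simp add: orth_proj_eq basis_expansion)

lemma linear_orth_proj: "linear (orth_proj Vh)"
  unfolding orth_proj_eq[abs_def]
  by (rule linearI) (simp_all add: inner_add_left scaleR_add_left sum.distrib scaleR_sum_right)

lemma norm_orth_proj_le: "norm (orth_proj Vh x) \<le> norm x"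
proof -
  have "norm (orth_proj Vh x) * norm (orth_proj Vh x) = x \<bullet> orth_proj Vh x"
    using inner_orth_proj[OF orth_proj_in_Vh, of x x] by (simp flip: power2_norm_eq_inner power2_eq_square)
  also have "\<dots> \<le> norm x * norm (orth_proj Vh x)"
    by (rule norm_cauchy_schwarz)
  finally show ?thesis
    by (cases "norm (orth_proj Vh x) = 0") auto
qed

lemma discrete_op_characterization:
  assumes x: "x \<in> Vh"
  shows "discrete_op lam e Vh x \<in> Vh \<and>
    (\<forall>z\<in>Vh. discrete_op lam e Vh x \<bullet> z = dotH_inner lam e 1 x z)"
proof -
  let ?y = "\<Sum>c\<in>basis. dotH_inner lam e 1 x c *\<^sub>R c"
  have "?y \<bullet> z = dotH_inner lam e 1 x z" if "z \<in> Vh" for z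
  proof -
    have "z \<in> span basis" using that by (simp add: span_basis)
    then have "z \<in> Vh \<and> ?y \<bullet> z = dotH_inner lam e 1 x z"
    proof (induction rule: span_induct_alt)
      case base
      then show ?case
        using subspace_Vh by (simp add: dotH_inner_def op_pow_def subspace_0)
    next
      case (step a c z)
      then have "z \<in> dotH lam e 1" "c \<in> dotH lam e 1" "a *\<^sub>R c \<in> dotH lam e 1"
        using step basis_in_Vh span_basis Vh_dotH subspace_Vh by (auto simp: subspace_scale subset_iff)
      then have "dotH_inner lam e 1 x (a *\<^sub>R c + z) = a * dotH_inner lam e 1 x c + dotH_inner lam e 1 x z"
        by (simp add: dotH_inner_def op_pow_add op_pow_scaleR inner_add_right)
      then show ?case
        using step basis_in_Vh subspace_Vh
        by (simp add: inner_add_right inner_basis_sum subspace_add subspace_scale)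
    qed
    then show ?thesis ..
  qed
  then have "\<exists>y. y \<in> Vh \<and> (\<forall>z\<in>Vh. y \<bullet> z = dotH_inner lam e 1 x z)"
    using basis_sum_in_Vh by blast
  moreover have "v = w" if "v \<in> Vh \<and> (\<forall>z\<in>Vh. v \<bullet> z = dotH_inner lam e 1 x z)"
    "w \<in> Vh \<and> (\<forall>z\<in>Vh. w \<bullet> z = dotH_inner lam e 1 x z)" for v w
    using eq_0_if_orthogonal[of "v - w"] that subspace_Vh by (auto simp: inner_diff_left subspace_diff)
  ultimately have "\<exists>!y. y \<in> Vh \<and> (\<forall>z\<in>Vh. y \<bullet> z = dotH_inner lam e 1 x z)"
    by blast
  from theI'[OF this] show ?thesis
    unfolding discrete_op_def .
qed

text \<open>
  The discrete operator is specified on \<open>Vh\<close> only; precomposition with the projection makes it linear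
  on the whole space.
\<close>

definition Ah :: "'h \<Rightarrow> 'h" where
  "Ah x = discrete_op lam e Vh (orth_proj Vh x)"

lemma Ah_in_Vh: "Ah x \<in> Vh"
  using discrete_op_characterization[OF orth_proj_in_Vh] by (simp add: Ah_def)

lemma inner_Ah: "z \<in> Vh \<Longrightarrow> Ah x \<bullet> z = dotH_inner lam e 1 (orth_proj Vh x) z"
  using discrete_op_characterization[OF orth_proj_in_Vh] by (simp add: Ah_def)

lemma linear_Ah: "linear Ah"
proof (rule linearI)
  have d: "orth_proj Vh x \<in> dotH lam e 1" for x
    using orth_proj_in_Vh Vh_dotH by blast
  show "Ah (x + y) = Ah x + Ah y" for x y
  proof -
    have "Ah (x + y) - (Ah x + Ah y) = 0"
      by (rule eq_0_if_orthogonal)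
        (auto intro!: subspace_diff subspace_add subspace_Vh Ah_in_Vh
          simp: inner_diff_left inner_add_left inner_Ah linear_add[OF linear_orth_proj] dotH_inner_def op_pow_add d)
    then show ?thesis by simp
  qed
  show "Ah (c *\<^sub>R x) = c *\<^sub>R Ah x" for c x
  proof -
    have "Ah (c *\<^sub>R x) - c *\<^sub>R Ah x = 0"
      by (rule eq_0_if_orthogonal)
        (auto intro!: subspace_diff subspace_scale subspace_Vh Ah_in_Vh
          simp: inner_diff_left inner_Ah linear_scale[OF linear_orth_proj] dotH_inner_def op_pow_scaleR d)
    then show ?thesis by simp
  qed
qed

lemma Ah_nonneg: "x \<in> Vh \<Longrightarrow> 0 \<le> Ah x \<bullet> x"
  by (simp add: inner_Ah orth_proj_id dotH_inner_def)

lemma Ah_bounded: "\<exists>K\<ge>0. \<forall>x\<in>Vh. norm (Ah x) \<le> K * norm x"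
proof (intro exI conjI ballI)
  fix x assume "x \<in> Vh"
  then have "Ah x = Ah (\<Sum>c\<in>basis. (x \<bullet> c) *\<^sub>R c)"
    by (simp add: basis_expansion)
  also have "\<dots> = (\<Sum>c\<in>basis. (x \<bullet> c) *\<^sub>R Ah c)"
    by (simp add: linear_sum[OF linear_Ah] linear_scale[OF linear_Ah])
  also have "norm \<dots> \<le> (\<Sum>c\<in>basis. norm (Ah c) * norm x)"
  proof (rule sum_norm_le)
    fix c assume "c \<in> basis"
    then have "\<bar>x \<bullet> c\<bar> \<le> norm x"
      using Cauchy_Schwarz_ineq2[of x c] inner_basis[of c c] by (simp add: norm_eq_sqrt_inner)
    then show "norm ((x \<bullet> c) *\<^sub>R Ah c) \<le> norm (Ah c) * norm x"
      by (simp add: mult.commute[of "norm (Ah c)"] mult_right_mono)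
  qed
  finally show "norm (Ah x) \<le> (\<Sum>c\<in>basis. norm (Ah c)) * norm x"
    by (simp add: sum_distrib_right)
qed (simp add: sum_nonneg)

text \<open>
  Coercivity, which gives injectivity of \<open>Id + \<theta> A\<^sub>h\<close> and the contraction property of
  its inverse.
\<close>

lemma resolvent_coercive:
  assumes "0 \<le> \<theta>" "y \<in> Vh"
  shows "norm y \<le> norm (y + \<theta> *\<^sub>R Ah y)"
proof -
  have "norm y * norm y \<le> y \<bullet> y + \<theta> * (Ah y \<bullet> y)"
    using assms Ah_nonneg by (simp flip: power2_norm_eq_inner power2_eq_square)
  also have "\<dots> = (y + \<theta> *\<^sub>R Ah y) \<bullet> y"
    by (simp add: inner_add_left)
  also have "\<dots> \<le> norm (y + \<theta> *\<^sub>R Ah y) * norm y"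
    by (rule norm_cauchy_schwarz)
  finally show ?thesis
    by (cases "norm y = 0") auto
qed

text \<open>
  An injective linear map of a finite dimensional space into itself is onto. Since \<open>Vh\<close> lies in a
  possibly infinite dimensional space, this is derived from the bound on the size of independent
  sets: a vector outside the span of the image of a basis would yield one independent vector too many.
\<close>

lemma resolvent_bij:
  assumes \<theta>: "0 \<le> \<theta>"
  shows "bij_betw (\<lambda>y. y + \<theta> *\<^sub>R Ah y) Vh Vh"
proof -
  let ?L = "\<lambda>y. y + \<theta> *\<^sub>R Ah y"
  have lin: "linear ?L"
    by (rule linearI) (simp_all add: linear_add[OF linear_Ah] linear_scale[OF linear_Ah] algebra_simps)
  have inj: "inj_on ?L Vh"
  proof (rule inj_onI)
    fix x y assume "x \<in> Vh" "y \<in> Vh" "?L x = ?L y"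
    then have "norm (x - y) \<le> norm (?L x - ?L y)"
      using resolvent_coercive[OF \<theta>, of "x - y"] linear_diff[OF lin, of x y] subspace_Vh
      by (simp add: subspace_diff)
    then show "x = y"
      using \<open>?L x = ?L y\<close> by simp
  qed
  have sub: "?L ` basis \<subseteq> span basis"
    using basis_in_Vh Ah_in_Vh subspace_Vh by (auto simp: span_basis intro!: subspace_add subspace_scale)
  have "independent basis"
    using inner_basis inner_basis[of 0 0]
    by (intro pairwise_orthogonal_independent) (auto simp: pairwise_def orthogonal_def)
  then have indep: "independent (?L ` basis)"
    using inj by (intro linear_independent_injective_image[OF lin]) (simp_all add: span_basis)
  have card: "card (?L ` basis) = card basis"
    using inj basis_in_Vh by (intro card_image) (auto simp: inj_on_def)
  have "Vh \<subseteq> span (?L ` basis)"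
  proof (rule subsetI, rule ccontr)
    fix v assume v: "v \<in> Vh" "v \<notin> span (?L ` basis)"
    then have insert: "independent (insert v (?L ` basis))"
      using indep by (intro independent_insertI) auto
    have "insert v (?L ` basis) \<subseteq> span basis"
      using sub v(1) by (simp add: span_basis)
    from independent_span_bound[OF finite_basis insert this]
    have "card (insert v (?L ` basis)) \<le> card basis" ..
    moreover have "v \<notin> ?L ` basis"
      using v(2) span_base[of v "?L ` basis"] by (rule contrapos_nn)
    ultimately show False
      using card finite_basis by simp
  qed
  then have "Vh \<subseteq> ?L ` Vh"
    using linear_span_image[OF lin, of basis] by (simp add: span_basis)
  moreover have "?L ` Vh \<subseteq> Vh"
    using Ah_in_Vh subspace_Vh by (auto intro!: subspace_add subspace_scale)
  ultimately show ?thesis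
    using inj by (auto simp: bij_betw_def)
qed

lemma S_op_eqI:
  assumes "0 \<le> \<theta>" "y \<in> Vh" "y + \<theta> *\<^sub>R Ah y = orth_proj Vh x"
  shows "S_op lam e Vh \<theta> x = y"
proof -
  let ?L = "\<lambda>y. y + \<theta> *\<^sub>R discrete_op lam e Vh y"
  have L: "?L z = z + \<theta> *\<^sub>R Ah z" if "z \<in> Vh" for z
    using that by (simp add: Ah_def orth_proj_id)
  have "inj_on ?L Vh"
    using resolvent_bij[OF assms(1)] inj_on_cong[of Vh ?L "\<lambda>y. y + \<theta> *\<^sub>R Ah y"] L by (simp add: bij_betw_def)
  then show ?thesis
    unfolding S_op_def using assms(2,3) L[OF assms(2)] by (intro the_inv_into_f_eq) simp_all
qed

lemma S_op_properties:
  assumes "0 \<le> \<theta>"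
  shows S_op_in_Vh: "S_op lam e Vh \<theta> x \<in> Vh"
    and S_op_resolvent: "S_op lam e Vh \<theta> x + \<theta> *\<^sub>R Ah (S_op lam e Vh \<theta> x) = orth_proj Vh x"
proof -
  obtain y where "y \<in> Vh" "y + \<theta> *\<^sub>R Ah y = orth_proj Vh x"
    using bij_betwE[OF bij_betw_inv_into[OF resolvent_bij[OF assms]]]
      bij_betw_inv_into_right[OF resolvent_bij[OF assms] orth_proj_in_Vh] orth_proj_in_Vh by blast
  then show "S_op lam e Vh \<theta> x \<in> Vh"
    "S_op lam e Vh \<theta> x + \<theta> *\<^sub>R Ah (S_op lam e Vh \<theta> x) = orth_proj Vh x"
    using S_op_eqI[OF assms] by auto
qed

lemma linear_S_op:
  assumes "0 \<le> \<theta>"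
  shows "linear (S_op lam e Vh \<theta>)"
proof (rule linearI)
  note A = linear_add[OF linear_Ah] linear_scale[OF linear_Ah]
  note P = linear_add[OF linear_orth_proj] linear_scale[OF linear_orth_proj]
  show "S_op lam e Vh \<theta> (x + y) = S_op lam e Vh \<theta> x + S_op lam e Vh \<theta> y" for x y
    using S_op_in_Vh[OF assms] S_op_resolvent[OF assms, of x] S_op_resolvent[OF assms, of y]
    by (intro S_op_eqI assms subspace_add subspace_Vh) (auto simp: A P algebra_simps)
  show "S_op lam e Vh \<theta> (c *\<^sub>R x) = c *\<^sub>R S_op lam e Vh \<theta> x" for c x
    using S_op_in_Vh[OF assms] S_op_resolvent[OF assms, of x, symmetric]
    by (intro S_op_eqI assms subspace_scale subspace_Vh) (auto simp: A P algebra_simps)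
qed

lemma norm_S_op_le: "0 \<le> \<theta> \<Longrightarrow> norm (S_op lam e Vh \<theta> x) \<le> norm x"
  using resolvent_coercive[OF _ S_op_in_Vh, of \<theta> \<theta> x] S_op_resolvent[of \<theta> x] norm_orth_proj_le[of x]
  by auto

text \<open>
  The resolvent identity shows that the resolvents depend Lipschitz continuously on the parameter,
  because the discrete operator is bounded.
\<close>

lemma continuous_on_S_op:
  "continuous_on ({0..} \<times> UNIV) (\<lambda>(\<theta>, x). S_op lam e Vh \<theta> x)"
proof -
  obtain K where K: "0 \<le> K" "\<And>x. x \<in> Vh \<Longrightarrow> norm (Ah x) \<le> K * norm x"
    using Ah_bounded by blast
  have bound: "norm (S_op lam e Vh \<theta> x - S_op lam e Vh \<theta>' x') \<le> norm (x - x') + \<bar>\<theta> - \<theta>'\<bar> * (K * norm x')"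
    if \<theta>: "0 \<le> \<theta>" "0 \<le> \<theta>'" for \<theta> \<theta>' x x'
  proof -
    let ?y = "S_op lam e Vh \<theta> x'" and ?y' = "S_op lam e Vh \<theta>' x'"
    have "(?y - ?y') + \<theta> *\<^sub>R Ah (?y - ?y') = (\<theta>' - \<theta>) *\<^sub>R Ah ?y'"
      using S_op_resolvent[OF \<theta>(1), of x'] S_op_resolvent[OF \<theta>(2), of x']
      by (simp add: linear_diff[OF linear_Ah] algebra_simps)
    then have "norm (?y - ?y') \<le> \<bar>\<theta> - \<theta>'\<bar> * norm (Ah ?y')"
      using resolvent_coercive[OF \<theta>(1), of "?y - ?y'"] S_op_in_Vh \<theta> subspace_Vh
      by (simp add: subspace_diff abs_minus_commute)
    also have "\<dots> \<le> \<bar>\<theta> - \<theta>'\<bar> * (K * norm x')"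
      using K(2)[OF S_op_in_Vh[OF \<theta>(2)], of x'] norm_S_op_le[OF \<theta>(2), of x'] K(1)
      by (intro mult_left_mono) (auto intro: order_trans mult_left_mono)
    finally have 1: "norm (?y - ?y') \<le> \<bar>\<theta> - \<theta>'\<bar> * (K * norm x')" .
    have "S_op lam e Vh \<theta> x - ?y = S_op lam e Vh \<theta> (x - x')"
      by (simp add: linear_diff[OF linear_S_op[OF \<theta>(1)]])
    then have 2: "norm (S_op lam e Vh \<theta> x - ?y) \<le> norm (x - x')"
      using norm_S_op_le[OF \<theta>(1)] by simp
    have "norm (S_op lam e Vh \<theta> x - ?y') \<le> norm (S_op lam e Vh \<theta> x - ?y) + norm (?y - ?y')"
      using norm_triangle_ineq[of "S_op lam e Vh \<theta> x - ?y" "?y - ?y'"] by simp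
    then show ?thesis
      using 1 2 by simp
  qed
  show ?thesis
    unfolding continuous_on_def
  proof (intro ballI)
    fix z :: "real \<times> 'h" assume "z \<in> {0..} \<times> UNIV"
    then obtain \<theta>' x' where z: "z = (\<theta>', x')" "0 \<le> \<theta>'" by auto
    have "((\<lambda>w. norm (snd w - x') + \<bar>fst w - \<theta>'\<bar> * (K * norm x')) \<longlongrightarrow>
        norm (snd z - x') + \<bar>fst z - \<theta>'\<bar> * (K * norm x')) (at z within {0..} \<times> UNIV)"
      by (intro tendsto_intros)
    then have lim: "((\<lambda>w. norm (snd w - x') + \<bar>fst w - \<theta>'\<bar> * (K * norm x')) \<longlongrightarrow> 0) (at z within {0..} \<times> UNIV)"
      by (simp add: z)
    have "((\<lambda>w. (case w of (\<theta>, x) \<Rightarrow> S_op lam e Vh \<theta> x) - S_op lam e Vh \<theta>' x') \<longlongrightarrow> 0)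
        (at z within {0..} \<times> UNIV)"
      using bound z(2) by (intro Lim_null_comparison[OF _ lim]) (auto simp: eventually_at_topological intro!: exI[of _ UNIV])
    then show "((\<lambda>(\<theta>, x). S_op lam e Vh \<theta> x) \<longlongrightarrow> (case z of (\<theta>, x) \<Rightarrow> S_op lam e Vh \<theta> x))
        (at z within {0..} \<times> UNIV)"
      unfolding z(1) by (simp add: LIM_zero_iff)
  qed
qed

end

section \<open>Measurability and moments at random times\<close>

lemma AE_pair_fstI:
  assumes N: "prob_space N" and P: "AE x in M. P x"
  shows "AE z in M \<Otimes>\<^sub>M N. P (fst z)"
proof -
  have "AE x in distr (M \<Otimes>\<^sub>M N) M fst. P x"
    unfolding prob_space.distr_pair_fst[OF N] by (rule P)
  then show ?thesis
    by (rule AE_distrD[OF measurable_fst])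
qed

lemma AE_pair_sndI:
  assumes M: "prob_space M" and N: "prob_space N" and P: "AE y in N. P y"
  shows "AE z in M \<Otimes>\<^sub>M N. P (snd z)"
proof -
  interpret pair_prob_space M N
    using M N by (simp add: pair_prob_space_def pair_sigma_finite_def prob_space_imp_sigma_finite)
  obtain A where A: "A \<in> null_sets N" "{y \<in> space N. \<not> P y} \<subseteq> A"
    using P by (auto simp: eventually_ae_filter)
  have "emeasure (M \<Otimes>\<^sub>M N) (space M \<times> A) = emeasure M (space M) * emeasure N A"
    using A by (intro M2.emeasure_pair_measure_Times) auto
  then have "space M \<times> A \<in> null_sets (M \<Otimes>\<^sub>M N)"
    using A by (auto intro!: null_setsI)
  then show ?thesis
    using A(2) by (intro AE_I') (auto simp: space_pair_measure)
qed

lemma Lp_functions_cong_AE: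
  assumes "X \<in> Lp_functions P F p" "AE \<omega> in P. X \<omega> = Y \<omega>"
  shows "Y \<in> Lp_functions P F p"
proof -
  obtain X' where X': "X' \<in> borel_measurable F" "AE \<omega> in P. X \<omega> = X' \<omega>"
    using assms(1) by (auto simp: Lp_functions_def)
  have "(\<integral>\<^sup>+\<omega>. ennreal (norm (Y \<omega>) powr p) \<partial>P) = (\<integral>\<^sup>+\<omega>. ennreal (norm (X \<omega>) powr p) \<partial>P)"
    using assms(2) by (intro nn_integral_cong_AE) auto
  moreover have "AE \<omega> in P. Y \<omega> = X' \<omega>"
    using assms(2) X'(2) by eventually_elim simp
  ultimately show ?thesis
    using X'(1) assms(1) by (auto simp: Lp_functions_def)
qed

text \<open>
  The maps that build up one step of the scheme depend on a random time and on a state. Joint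
  continuity makes their compositions measurable, linear growth in the state makes them integrable.
\<close>

lemma Lp_functions_compose:
  fixes G :: "real \<Rightarrow> 'b::{real_normed_vector,second_countable_topology} \<Rightarrow> 'c::{real_normed_vector,second_countable_topology}"
  assumes p: "1 \<le> p" and P: "prob_space P" and F: "subalgebra P F"
    and X: "X \<in> Lp_functions P F p" and \<theta>: "\<theta> \<in> borel_measurable F" "\<And>\<omega>. \<theta> \<omega> \<in> I"
    and G: "continuous_on (I \<times> UNIV) (\<lambda>(t, x). G t x)"
    and growth: "\<And>t x. t \<in> I \<Longrightarrow> norm (G t x) \<le> a + b * norm x"
  shows "(\<lambda>\<omega>. G (\<theta> \<omega>) (X \<omega>)) \<in> Lp_functions P F p"
proof -
  have p0: "0 < p" using p by simp
  obtain X' where X': "X' \<in> borel_measurable F" "AE \<omega> in P. X \<omega> = X' \<omega>"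
    using X by (auto simp: Lp_functions_def)
  note sum = Lp_add(1)[OF p F Lp_const[OF P, of a F p] Lp_scaleR(1)[OF p F Lp_functions_norm[OF X], of b]]
  have "(\<lambda>\<omega>. (\<theta> \<omega>, X' \<omega>)) \<in> measurable F (restrict_space borel (I \<times> UNIV))"
    using \<theta> X'(1) by (intro measurable_restrict_space2) auto
  from measurable_comp[OF this borel_measurable_continuous_on_restrict[OF G]]
  have "(\<lambda>\<omega>. G (\<theta> \<omega>) (X' \<omega>)) \<in> borel_measurable F"
    by (simp add: o_def)
  moreover have "AE \<omega> in P. G (\<theta> \<omega>) (X \<omega>) = G (\<theta> \<omega>) (X' \<omega>)"
    using X'(2) by auto
  ultimately have "\<exists>Y'\<in>borel_measurable F. AE \<omega> in P. G (\<theta> \<omega>) (X \<omega>) = Y' \<omega>"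
    by (intro bexI[where x = "\<lambda>\<omega>. G (\<theta> \<omega>) (X' \<omega>)"])
  then show ?thesis
  proof (rule Lp_functions_dominated[OF p0 sum])
    show "AE \<omega> in P. norm (G (\<theta> \<omega>) (X \<omega>)) \<le> norm (a + b *\<^sub>R norm (X \<omega>))"
      using growth[OF \<theta>(2)] by (auto intro: order_trans[OF _ abs_ge_self])
  qed
qed

lemma subalgebra_pair_measure:
  assumes "subalgebra M F" "subalgebra N G"
  shows "subalgebra (M \<Otimes>\<^sub>M N) (F \<Otimes>\<^sub>M G)"
proof -
  have space: "space F = space M" "space G = space N" and sets: "sets F \<subseteq> sets M" "sets G \<subseteq> sets N"
    using assms by (auto simp: subalgebra_def)
  have "{a \<times> b |a b. a \<in> sets F \<and> b \<in> sets G} \<subseteq> sets (M \<Otimes>\<^sub>M N)"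
    using sets by auto
  from sets.sigma_sets_subset[OF this] show ?thesis
    by (simp add: subalgebra_def space_pair_measure sets_pair_measure[of F G] space)
qed

text \<open>
  A process with continuous paths, evaluated at a random time that lives on the second factor of a
  product space. Rounding the time down to a grid gives measurable approximations, which converge
  by path continuity; the discontinuous paths lie in a null set that belongs to \<open>F\<close> and can be
  removed. By Fubini's theorem a uniform moment bound at deterministic times carries over to the random time.
\<close>

lemma Lp_functions_random_time:
  fixes D :: "real \<Rightarrow> 'w \<Rightarrow> 'b::{real_normed_vector,second_countable_topology}"
  assumes M: "prob_space M" and N: "prob_space N"
    and F: "subalgebra M F" "null_sets M \<subseteq> sets F" and G: "subalgebra N G"
    and D: "\<And>t. t \<in> {0..1} \<Longrightarrow> D t \<in> borel_measurable F"
    and paths: "AE \<omega> in M. continuous_on {0..1} (\<lambda>t. D t \<omega>)"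
    and \<theta>: "\<theta> \<in> borel_measurable G" "\<And>\<omega>'. \<theta> \<omega>' \<in> {0..1}"
    and moment: "\<And>t. t \<in> {0..1} \<Longrightarrow> (\<integral>\<^sup>+\<omega>. ennreal (norm (D t \<omega>) powr p) \<partial>M) \<le> ennreal C"
  shows "(\<lambda>(\<omega>, \<omega>'). D (\<theta> \<omega>') \<omega>) \<in> Lp_functions (M \<Otimes>\<^sub>M N) (F \<Otimes>\<^sub>M G) p"
proof -
  interpret pair_prob_space M N
    using M N by (simp add: pair_prob_space_def pair_sigma_finite_def prob_space_imp_sigma_finite)
  obtain A where A: "A \<in> null_sets M" "{\<omega> \<in> space M. \<not> continuous_on {0..1} (\<lambda>t. D t \<omega>)} \<subseteq> A"
    using paths by (auto simp: eventually_ae_filter)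
  define D' where "D' t \<omega> = (if \<omega> \<in> A then 0 else D t \<omega>)" for t \<omega>
  have AF: "A \<in> sets F"
    using A(1) F(2) by blast
  have D': "D' t \<in> borel_measurable F" if "t \<in> {0..1}" for t
    unfolding D'_def using AF D[OF that] by (intro measurable_If_set) auto
  have AE_D': "AE \<omega> in M. \<forall>t. D t \<omega> = D' t \<omega>"
    using AE_not_in[OF A(1)] by eventually_elim (auto simp: D'_def)
  have cont: "continuous_on {0..1} (\<lambda>t. D' t \<omega>)" if "\<omega> \<in> space M" for \<omega>
    using A(2) that by (cases "\<omega> \<in> A") (auto simp: D'_def)
  let ?Y = "\<lambda>z. D' (\<theta> (snd z)) (fst z)"
  \<comment> \<open>The index of the last point before \<open>t\<close> of the grid of width \<open>1 / (n + 1)\<close>; the minimum keeps \<open>t n i\<close> in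
    the unit interval for all indices \<open>i\<close>, as measurability is shown for each \<open>i\<close> separately.\<close>
  define i where "i n t = nat \<lfloor>real (Suc n) * t\<rfloor>" for n t
  define t where "t n i = min 1 (real i / real (Suc n))" for n i
  have "(\<lambda>n. D' (t n (i n (\<theta> (snd z)))) (fst z)) \<longlonglongrightarrow> ?Y z" if z: "z \<in> space (F \<Otimes>\<^sub>M G)" for z
  proof -
    have "fst z \<in> space M"
      using z F(1) by (auto simp: space_pair_measure subalgebra_def)
    let ?\<theta> = "\<theta> (snd z)"
    have near: "?\<theta> - 1 / real (Suc n) \<le> t n (i n ?\<theta>) \<and> t n (i n ?\<theta>) \<le> ?\<theta>" for n
    proof -
      have "0 \<le> real (Suc n) * ?\<theta>"
        using \<theta>(2)[of "snd z"] by simp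
      then have "real (i n ?\<theta>) \<le> real (Suc n) * ?\<theta>" "real (Suc n) * ?\<theta> \<le> real (i n ?\<theta>) + 1"
        unfolding i_def by linarith+
      then have "real (i n ?\<theta>) / real (Suc n) \<le> ?\<theta>" "?\<theta> \<le> (real (i n ?\<theta>) + 1) / real (Suc n)"
        by (simp_all add: pos_divide_le_eq pos_le_divide_eq mult.commute del: of_nat_Suc)
      then have "real (i n ?\<theta>) / real (Suc n) \<le> ?\<theta>" "?\<theta> - 1 / real (Suc n) \<le> real (i n ?\<theta>) / real (Suc n)"
        by (simp_all add: add_divide_distrib del: of_nat_Suc)
      then show ?thesis
        using \<theta>(2)[of "snd z"] zero_le_divide_1_iff[of "real (Suc n)"] unfolding t_def atLeastAtMost_iff by linarith
    qed
    have "(\<lambda>n. 1 / real (Suc n)) \<longlonglongrightarrow> 0"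
      using LIMSEQ_inverse_real_of_nat by (simp add: inverse_eq_divide)
    then have "(\<lambda>n. ?\<theta> - 1 / real (Suc n)) \<longlonglongrightarrow> ?\<theta>"
      using tendsto_diff[OF tendsto_const] by fastforce
    then have lim: "(\<lambda>n. t n (i n ?\<theta>)) \<longlonglongrightarrow> ?\<theta>"
      by (rule tendsto_sandwich[OF _ _ _ tendsto_const, rotated 2]) (use near in auto)
    have "t n j \<in> {0..1}" for n j
      by (simp add: t_def)
    then show ?thesis
      using continuous_on_tendsto_compose[OF cont[OF \<open>fst z \<in> space M\<close>] lim] \<theta>(2) by simp
  qed
  moreover have "(\<lambda>z. D' (t n (i n (\<theta> (snd z)))) (fst z)) \<in> borel_measurable (F \<Otimes>\<^sub>M G)" for n
  proof (rule measurable_compose_countable)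
    show "(\<lambda>z. D' (t n j) (fst z)) \<in> borel_measurable (F \<Otimes>\<^sub>M G)" for j
      by (rule measurable_compose[OF measurable_fst D']) (simp add: t_def)
    have [measurable]: "\<theta> \<in> borel_measurable G"
      by (rule \<theta>(1))
    show "(\<lambda>z. i n (\<theta> (snd z))) \<in> measurable (F \<Otimes>\<^sub>M G) (count_space UNIV)"
      unfolding i_def by measurable
  qed
  ultimately have Y: "?Y \<in> borel_measurable (F \<Otimes>\<^sub>M G)"
    by (rule borel_measurable_LIMSEQ_metric[rotated])
  have YP: "?Y \<in> borel_measurable (M \<Otimes>\<^sub>M N)"
    by (rule measurable_from_subalg[OF subalgebra_pair_measure[OF F(1) G] Y])
  have AE_eq: "AE z in M \<Otimes>\<^sub>M N. (case z of (\<omega>, \<omega>') \<Rightarrow> D (\<theta> \<omega>') \<omega>) = ?Y z"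
    using AE_pair_fstI[OF N AE_D'] by eventually_elim auto
  have "(\<integral>\<^sup>+z. ennreal (norm (case z of (\<omega>, \<omega>') \<Rightarrow> D (\<theta> \<omega>') \<omega>) powr p) \<partial>(M \<Otimes>\<^sub>M N))
      = (\<integral>\<^sup>+z. ennreal (norm (?Y z) powr p) \<partial>(M \<Otimes>\<^sub>M N))"
    using AE_eq by (intro nn_integral_cong_AE) (auto elim!: eventually_mono)
  also have "\<dots> = (\<integral>\<^sup>+\<omega>'. \<integral>\<^sup>+\<omega>. ennreal (norm (D' (\<theta> \<omega>') \<omega>) powr p) \<partial>M \<partial>N)"
    using YP nn_integral_snd[of "\<lambda>z. ennreal (norm (?Y z) powr p)"] by (simp add: case_prod_beta)
  also have "\<dots> \<le> (\<integral>\<^sup>+\<omega>'. ennreal C \<partial>N)"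
  proof (rule nn_integral_mono)
    fix \<omega>'
    have "(\<integral>\<^sup>+\<omega>. ennreal (norm (D' (\<theta> \<omega>') \<omega>) powr p) \<partial>M) = (\<integral>\<^sup>+\<omega>. ennreal (norm (D (\<theta> \<omega>') \<omega>) powr p) \<partial>M)"
      using AE_D' by (intro nn_integral_cong_AE) (auto elim!: eventually_mono)
    then show "(\<integral>\<^sup>+\<omega>. ennreal (norm (D' (\<theta> \<omega>') \<omega>) powr p) \<partial>M) \<le> ennreal C"
      using moment[OF \<theta>(2)] by simp
  qed
  also have "\<dots> < \<infinity>"
    by (simp add: M2.emeasure_space_1)
  finally show ?thesis
    unfolding Lp_functions_def by (intro CollectI conjI bexI[where x = ?Y] AE_eq Y)
qed

text \<open>
  Centred Gaussian moments of any order are bounded uniformly for bounded variances: \<open>\<bar>x\<bar>\<^sup>p\<close> is at most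
  \<open>1 + x\<^sup>2\<^sup>m\<close>, and the even moments are explicit and increase with the variance. For \<open>w = 0\<close> the quotient
  in the bound is 0 by the convention on division by 0, which is correct as \<open>X\<close> then vanishes.
\<close>

lemma normal_moment_bound:
  assumes M: "prob_space M" and X: "normal_rv M 0 v X" and v: "0 \<le> v" "v \<le> w" and p: "0 < p" "p \<le> real (2 * m)"
  shows "(\<integral>\<^sup>+\<omega>. ennreal (norm (X \<omega>) powr p) \<partial>M) \<le> ennreal (1 + fact (2 * m) / ((2 / w) ^ m * fact m))"
proof (cases "v = 0")
  case True
  then have "AE \<omega> in M. X \<omega> = 0"
    using X by (simp add: normal_rv_def)
  then have "(\<integral>\<^sup>+\<omega>. ennreal (norm (X \<omega>) powr p) \<partial>M) = (\<integral>\<^sup>+\<omega>. 0 \<partial>M)"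
    by (intro nn_integral_cong_AE) auto
  then show ?thesis by simp
next
  case False
  then have dist: "distributed M lborel X (normal_density 0 (sqrt v))" and v0: "0 < v"
    using X v by (auto simp: normal_rv_def)
  let ?n = "normal_density 0 (sqrt v)"
  have bound: "norm x powr p \<le> 1 + x ^ (2 * m)" for x :: real
  proof (cases "\<bar>x\<bar> \<le> 1")
    case True
    then have "norm x powr p \<le> 1"
      using p by (simp add: powr_le1)
    then show ?thesis by (simp add: add_increasing2)
  next
    case False
    then have "norm x powr p \<le> \<bar>x\<bar> powr real (2 * m)"
      using p by (auto intro!: powr_mono)
    also have "\<dots> = x ^ (2 * m)"
      using False by (subst powr_realpow) (auto simp: power_even_abs)
    finally show ?thesis by simp
  qed
  have int: "has_bochner_integral lborel (\<lambda>x. ?n x * 1 + ?n x * (x - 0) ^ (2 * m)) (1 + fact (2 * m) / ((2 / (sqrt v)\<^sup>2) ^ m * fact m))"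
    using v0 normal_moment_even[of "sqrt v" 0 m] normal_moment_even[of "sqrt v" 0 0]
    by (intro has_bochner_integral_add) auto
  have "(\<integral>\<^sup>+\<omega>. ennreal (norm (X \<omega>) powr p) \<partial>M) = (\<integral>\<^sup>+x. ennreal (?n x) * ennreal (norm x powr p) \<partial>lborel)"
    by (rule distributed_nn_integral[OF dist, symmetric]) measurable
  also have "\<dots> \<le> (\<integral>\<^sup>+x. ennreal (?n x * 1 + ?n x * (x - 0) ^ (2 * m)) \<partial>lborel)"
  proof (rule nn_integral_mono)
    fix x :: real
    show "ennreal (?n x) * ennreal (norm x powr p) \<le> ennreal (?n x * 1 + ?n x * (x - 0) ^ (2 * m))"
      using mult_left_mono[OF bound[of x], of "?n x"] unfolding ennreal_mult'[OF normal_density_nonneg, symmetric]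
      by (intro ennreal_leI) (simp add: distrib_left)
  qed
  also have "\<dots> = ennreal (1 + fact (2 * m) / ((2 / (sqrt v)\<^sup>2) ^ m * fact m))"
    using int by (intro nn_integral_eq_integral[THEN trans]) (auto simp: has_bochner_integral_iff)
  also have "\<dots> \<le> ennreal (1 + fact (2 * m) / ((2 / w) ^ m * fact m))"
  proof (intro ennreal_leI add_left_mono divide_left_mono)
    have "2 / w \<le> 2 / (sqrt v)\<^sup>2"
      using v v0 by (simp add: frac_le)
    then show "(2 / w) ^ m * fact m \<le> (2 / (sqrt v)\<^sup>2) ^ m * fact m"
      using v v0 by (intro mult_right_mono power_mono) auto
    show "0 < (2 / (sqrt v)\<^sup>2) ^ m * fact m * ((2 / w) ^ m * fact m)"
      using v v0 by (intro mult_pos_pos zero_less_power divide_pos_pos) auto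
  qed simp
  finally show ?thesis .
qed

section \<open>Hilbert--Schmidt operators and truncated noise\<close>

lemma hilbert_schmidt_diff:
  assumes A: "hilbert_schmidt phi A" and B: "hilbert_schmidt phi B"
  shows "hilbert_schmidt phi (\<lambda>x. A x - B x)"
proof -
  let ?a = "\<lambda>j. norm (A (phi j))" and ?b = "\<lambda>j. norm (B (phi j))"
  have bound: "norm ((norm (A (phi j) - B (phi j)))\<^sup>2) \<le> 2 * ((?a j)\<^sup>2 + (?b j)\<^sup>2)" for j
  proof -
    have "(norm (A (phi j) - B (phi j)))\<^sup>2 \<le> (?a j + ?b j)\<^sup>2"
      by (intro power_mono norm_triangle_ineq4) auto
    also have "\<dots> \<le> 2 * ((?a j)\<^sup>2 + (?b j)\<^sup>2)"
      using sum_squares_bound[of "?a j" "?b j"] by (simp add: power2_sum)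
    finally show ?thesis by simp
  qed
  have "summable (\<lambda>j. 2 * ((?a j)\<^sup>2 + (?b j)\<^sup>2))"
    using A B by (intro summable_mult summable_add) (simp_all add: hilbert_schmidt_def)
  from summable_comparison_test'[OF this bound]
  have "summable (\<lambda>j. (norm (A (phi j) - B (phi j)))\<^sup>2)" .
  moreover have "bounded_linear (\<lambda>x. A x - B x)"
    using A B by (intro bounded_linear_sub) (simp_all add: hilbert_schmidt_def)
  ultimately show ?thesis
    by (simp add: hilbert_schmidt_def)
qed

lemma L20_diff: "v \<in> L20 mu phi \<Longrightarrow> w \<in> L20 mu phi \<Longrightarrow> v - w \<in> L20 mu phi"
  using hilbert_schmidt_diff[of phi "v \<circ> op_pow mu phi (1/2)" "w \<circ> op_pow mu phi (1/2)"]
  by (simp add: L20_def o_def)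

lemma norm_L20_le:
  assumes "L \<in> L20 mu phi"
  shows "norm (L (op_pow mu phi (1/2) (phi j))) \<le> L20_norm mu phi L"
proof -
  let ?B = "L \<circ> op_pow mu phi (1/2)"
  have "(\<Sum>i\<in>{j}. (norm (?B (phi i)))\<^sup>2) \<le> (\<Sum>i. (norm (?B (phi i)))\<^sup>2)"
    using assms by (intro sum_le_suminf) (auto simp: L20_def hilbert_schmidt_def)
  then have "sqrt ((norm (?B (phi j)))\<^sup>2) \<le> sqrt (\<Sum>i. (norm (?B (phi i)))\<^sup>2)"
    by (intro real_sqrt_le_mono) simp
  then show ?thesis
    by (simp add: L20_norm_def hs_norm_def)
qed

lemma continuous_on_L20_apply:
  assumes "L20_continuous mu phi T v"
  shows "continuous_on {0..T} (\<lambda>t. v t (op_pow mu phi (1/2) (phi j)))"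
  unfolding continuous_on_def
proof
  fix t assume t: "t \<in> {0..T}"
  have lim: "((\<lambda>s. L20_norm mu phi (v s - v t)) \<longlongrightarrow> 0) (at t within {0..T})"
    and v: "\<And>s. s \<in> {0..T} \<Longrightarrow> v s \<in> L20 mu phi"
    using assms t by (auto simp: L20_continuous_def)
  have "((\<lambda>s. v s (op_pow mu phi (1/2) (phi j)) - v t (op_pow mu phi (1/2) (phi j))) \<longlongrightarrow> 0) (at t within {0..T})"
  proof (rule Lim_null_comparison[OF _ lim])
    have "norm (v s (op_pow mu phi (1/2) (phi j)) - v t (op_pow mu phi (1/2) (phi j))) \<le> L20_norm mu phi (v s - v t)"
      if "s \<in> {0..T}" for s
      using norm_L20_le[OF L20_diff[OF v[OF that] v[OF t]]] by simp
    then show "\<forall>\<^sub>F s in at t within {0..T}. norm (v s (op_pow mu phi (1/2) (phi j)) - v t (op_pow mu phi (1/2) (phi j)))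
        \<le> L20_norm mu phi (v s - v t)"
      by (auto simp: eventually_at_topological intro!: exI[of _ UNIV])
  qed
  then show "((\<lambda>s. v s (op_pow mu phi (1/2) (phi j))) \<longlongrightarrow> v t (op_pow mu phi (1/2) (phi j))) (at t within {0..T})"
    by (simp add: LIM_zero_iff)
qed

text \<open>
  An element of \<open>L20\<close> is only known to be linear on the range of \<open>Q\<^sup>1\<^sup>/\<^sup>2\<close>, so the increment of the
  truncated noise has to be exhibited as an element of that range.
\<close>

lemma noise_increment_eq_op_pow:
  assumes phi: "orthonormal_basis phi" and mu: "\<And>j. 0 \<le> mu j"
  shows "noise_increment mu phi W M \<kappa> t \<omega> = op_pow mu phi (1/2)
    (\<Sum>j<M. (beta mu phi W j (t + \<kappa>) \<omega> - beta mu phi W j t \<omega>) *\<^sub>R phi j)"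
proof -
  let ?b = "\<lambda>j. beta mu phi W j (t + \<kappa>) \<omega> - beta mu phi W j t \<omega>"
  have coeff: "(\<Sum>j<M. ?b j *\<^sub>R phi j) \<bullet> phi i = (if i < M then ?b i else 0)" for i
    by (simp add: inner_sum_left orthonormal_basis_inner[OF phi] if_distrib[of "(*) _"] cong: if_cong)
  have "op_pow mu phi (1/2) (\<Sum>j<M. ?b j *\<^sub>R phi j) = (\<Sum>j<M. (mu j powr (1/2) * ?b j) *\<^sub>R phi j)"
    unfolding op_pow_def coeff by (subst suminf_finite[of "{..<M}"]) auto
  also have "\<dots> = noise_increment mu phi W M \<kappa> t \<omega>"
    using mu by (simp add: noise_increment_def truncated_noise_def powr_half_sqrt scaleR_diff_left right_diff_distrib sum_subtractf)
  finally show ?thesis ..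
qed

lemma L20_noise_increment:
  assumes L: "L \<in> L20 mu phi" and phi: "orthonormal_basis phi" and mu: "\<And>j. 0 \<le> mu j"
  shows "L (noise_increment mu phi W M \<kappa> t \<omega>) =
    (\<Sum>j<M. (beta mu phi W j (t + \<kappa>) \<omega> - beta mu phi W j t \<omega>) *\<^sub>R L (op_pow mu phi (1/2) (phi j)))"
proof -
  have "bounded_linear (L \<circ> op_pow mu phi (1/2))"
    using L by (simp add: L20_def hilbert_schmidt_def)
  then have "linear (L \<circ> op_pow mu phi (1/2))"
    by (rule bounded_linear.linear)
  note sum = linear_sum[OF this, unfolded o_apply] and scale = linear_scale[OF this, unfolded o_apply]
  show ?thesis
    unfolding noise_increment_eq_op_pow[OF phi mu] sum scale ..
qed

section \<open>The randomized Galerkin scheme\<close>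

locale randomized_galerkin = galerkin_space lam e Vh
  for lam :: "nat \<Rightarrow> real" and e :: "nat \<Rightarrow> 'h::{real_inner,banach,second_countable_topology}" and Vh +
  fixes MW :: "'w measure" and FW :: "real \<Rightarrow> 'w measure"
    and MT :: "'t measure" and \<tau> :: "nat \<Rightarrow> 't \<Rightarrow> real"
    and W :: "real \<Rightarrow> 'w \<Rightarrow> 'u::{real_inner,banach,second_countable_topology}"
    and Q :: "'u \<Rightarrow> 'u" and mu :: "nat \<Rightarrow> real" and phi :: "nat \<Rightarrow> 'u"
    and f :: "real \<Rightarrow> 'h \<Rightarrow> 'h" and g :: "real \<Rightarrow> 'u \<Rightarrow> 'h"
    and X0 :: "'w \<Rightarrow> 'h" and T p r Cf Cg k :: real and M :: nat
  assumes p: "2 \<le> p" and r: "0 \<le> r" and k: "0 < k" "k < T"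
    and usual: "usual_conditions MW T FW" and Wiener: "Q_Wiener_process MW T FW Q W"
    and phi: "orthonormal_basis phi" and Q_phi: "\<And>j. Q (phi j) = mu j *\<^sub>R phi j" and mu: "\<And>j. 0 \<le> mu j"
    and e: "orthonormal_basis e" and lam: "\<And>j. 0 < lam j" "incseq lam"
    and X0: "X0 \<in> borel_measurable (FW 0)" "AE \<omega> in MW. X0 \<omega> \<in> dotH lam e r"
      "(\<integral>\<^sup>+\<omega>. ennreal (dotH_norm lam e r (X0 \<omega>) powr p) \<partial>MW) < \<infinity>"
    and f_continuous: "continuous_on ({0..T} \<times> UNIV) (\<lambda>(t, u). f t u)" and Cf: "0 < Cf"
    and f_lipschitz: "\<And>t u1 u2. t \<in> {0..T} \<Longrightarrow> norm (f t u1 - f t u2) \<le> Cf * norm (u1 - u2)"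
    and g_continuous: "L20_continuous mu phi T g" and g_bounded: "\<And>t. t \<in> {0..T} \<Longrightarrow> L20_norm mu phi (g t) \<le> Cg"
    and MT: "prob_space MT" and \<tau>_measurable: "\<And>n. 1 \<le> n \<Longrightarrow> \<tau> n \<in> borel_measurable MT"
    and \<tau>_range: "\<And>n. 1 \<le> n \<Longrightarrow> AE \<omega> in MT. \<tau> n \<omega> \<in> {0..1}"
begin

abbreviation "N \<equiv> num_steps T k"
abbreviation "P \<equiv> MW \<Otimes>\<^sub>M MT"
abbreviation "F \<equiv> grid_algebra FW MT \<tau> k"
abbreviation "S \<equiv> S_op lam e Vh"

text \<open>
  The random numbers lie in the unit interval only almost surely. Clamping them puts all
  randomized times into the current grid interval for every sample point, as the measurability of
  one step with respect to the next grid algebra requires.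
\<close>

definition \<theta> :: "nat \<Rightarrow> 't \<Rightarrow> real" where
  "\<theta> n \<omega> = min 1 (max 0 (\<tau> n \<omega>))"

definition \<Phi> :: "nat \<Rightarrow> 'h \<Rightarrow> 'w \<times> 't \<Rightarrow> 'h" where
  "\<Phi> n x = (\<lambda>(\<omega>, \<omega>'). Phi lam e mu phi f g W Vh k M n x (\<tau> n \<omega>') \<omega>)"

lemma T_pos: "0 < T"
  using k by simp

lemma p_ge_1: "1 \<le> p"
  using p by simp

lemma MW: "prob_space MW"
  using usual by (simp add: usual_conditions_def)

lemma P: "prob_space P"
proof -
  interpret pair_prob_space MW MT
    using MW MT by (simp add: pair_prob_space_def pair_sigma_finite_def prob_space_imp_sigma_finite)
  show ?thesis
    by (rule P.prob_space_axioms)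
qed

lemma grid_time_0: "grid_time k 0 = 0"
  by (simp add: grid_time_def)

lemma grid_time_Suc: "grid_time k (Suc n) = grid_time k n + k"
  by (simp add: grid_time_def algebra_simps)

lemma grid_time_in:
  assumes "n \<le> N"
  shows "grid_time k n \<in> {0..T}"
proof -
  have "real n * k \<le> real N * k"
    using assms k by (intro mult_right_mono) auto
  then have "real n * k \<le> T"
    using num_steps_bounds(1)[OF k] by (rule order_trans)
  then show ?thesis
    using k by (simp add: grid_time_def)
qed

lemma intermediate_time_in:
  assumes "n < N" "t \<in> {0..1}"
  shows "grid_time k n + t * k \<in> {grid_time k n..grid_time k (Suc n)}" "grid_time k n + t * k \<in> {0..T}"
proof -
  have "0 \<le> t * k" "t * k \<le> k"
    using assms(2) k by (auto simp: mult_left_le_one_le)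
  then show "grid_time k n + t * k \<in> {grid_time k n..grid_time k (Suc n)}" "grid_time k n + t * k \<in> {0..T}"
    using grid_time_in[of n] grid_time_in[of "Suc n"] assms(1) by (auto simp: grid_time_Suc)
qed

lemma subalgebra_FW: "t \<in> {0..T} \<Longrightarrow> subalgebra MW (FW t)"
  using usual by (simp add: usual_conditions_def)

lemma subalgebra_FW_mono: "0 \<le> s \<Longrightarrow> s \<le> t \<Longrightarrow> t \<le> T \<Longrightarrow> subalgebra (FW t) (FW s)"
  using usual subalgebra_FW[of s] subalgebra_FW[of t] by (auto simp: usual_conditions_def subalgebra_def)

lemma null_sets_FW:
  assumes "t \<in> {0..T}"
  shows "null_sets MW \<subseteq> sets (FW t)"
proof -
  have "null_sets MW \<subseteq> sets (FW 0)"
    using usual by (simp add: usual_conditions_def)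
  also have "\<dots> \<subseteq> sets (FW t)"
    using subalgebra_FW_mono[of 0 t] assms by (simp add: subalgebra_def)
  finally show ?thesis .
qed

lemma sets_tau_algebra:
  "sets (tau_algebra MT \<tau> n) = sigma_sets (space MT) {\<tau> j -` B \<inter> space MT | j B. j \<in> {1..n} \<and> B \<in> sets borel}"
  unfolding tau_algebra_def by (rule sets_measure_of) auto

lemma space_tau_algebra: "space (tau_algebra MT \<tau> n) = space MT"
  unfolding tau_algebra_def by (rule space_measure_of) auto

lemma subalgebra_tau: "subalgebra MT (tau_algebra MT \<tau> n)"
  unfolding subalgebra_def sets_tau_algebra space_tau_algebra
  using \<tau>_measurable by (auto intro!: sets.sigma_sets_subset measurable_sets)

lemma subalgebra_tau_mono:
  assumes "m \<le> n"
  shows "subalgebra (tau_algebra MT \<tau> n) (tau_algebra MT \<tau> m)"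
proof -
  have "{1..m} \<subseteq> {1..n}"
    using assms by simp
  then have "{\<tau> j -` B \<inter> space MT | j B. j \<in> {1..m} \<and> B \<in> sets borel}
      \<subseteq> {\<tau> j -` B \<inter> space MT | j B. j \<in> {1..n} \<and> B \<in> sets borel}"
    by blast
  then show ?thesis
    unfolding subalgebra_def sets_tau_algebra space_tau_algebra by (intro conjI refl sigma_sets_mono')
qed

lemma subalgebra_F: "n \<le> N \<Longrightarrow> subalgebra P (F n)"
  unfolding grid_algebra_def by (intro subalgebra_pair_measure subalgebra_FW grid_time_in subalgebra_tau)

lemma subalgebra_F_Suc: "n < N \<Longrightarrow> subalgebra (F (Suc n)) (F n)"
  unfolding grid_algebra_def using grid_time_in[of n] grid_time_in[of "Suc n"] k
  by (intro subalgebra_pair_measure subalgebra_FW_mono subalgebra_tau_mono) (auto simp: grid_time_Suc)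

lemma \<theta>_in: "\<theta> n \<omega> \<in> {0..1}"
  by (simp add: \<theta>_def)

lemma \<theta>_measurable:
  assumes "1 \<le> n"
  shows "\<theta> n \<in> borel_measurable (tau_algebra MT \<tau> n)"
proof -
  have "\<tau> n -` B \<inter> space MT \<in> sigma_sets (space MT) {\<tau> j -` B \<inter> space MT | j B. j \<in> {1..n} \<and> B \<in> sets borel}"
    if "B \<in> sets borel" for B
    using assms that by (intro sigma_sets.Basic) auto
  then have "\<tau> n \<in> borel_measurable (tau_algebra MT \<tau> n)"
    by (intro measurableI) (auto simp: sets_tau_algebra space_tau_algebra)
  then show ?thesis
    unfolding \<theta>_def by measurable
qed

lemma AE_\<theta>:
  assumes "1 \<le> n"
  shows "AE z in P. \<theta> n (snd z) = \<tau> n (snd z)"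
  using AE_pair_sndI[OF MW MT \<tau>_range[OF assms]] by eventually_elim (auto simp: \<theta>_def)

subsection \<open>Drift and noise terms\<close>

lemma f_growth: "\<exists>K. \<forall>t\<in>{0..T}. \<forall>u. norm (f t u) \<le> K + Cf * norm u"
proof -
  have "continuous_on {0..T} (\<lambda>t. (\<lambda>(t, u). f t u) (t, 0))"
    by (rule continuous_on_compose2[OF f_continuous]) (auto intro!: continuous_intros)
  then have "bounded ((\<lambda>t. f t 0) ` {0..T})"
    by (intro compact_imp_bounded compact_continuous_image) auto
  then obtain K where K: "\<And>t. t \<in> {0..T} \<Longrightarrow> norm (f t 0) \<le> K"
    unfolding bounded_iff by blast
  have "norm (f t u) \<le> K + Cf * norm u" if t: "t \<in> {0..T}" for t u
  proof -
    have "norm (f t u) \<le> norm (f t 0) + norm (f t u - f t 0)"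
      by norm
    then show ?thesis
      using K[OF t] f_lipschitz[OF t, of u 0] by simp
  qed
  then show ?thesis by blast
qed

text \<open>
  The coordinates of the Wiener increments up to a randomized time have finite moments because
  they are Gaussian with variance at most \<open>T * mu j\<close> at deterministic times.
\<close>

lemma beta_increment_Lp:
  assumes n: "n < N" and \<sigma>: "\<sigma> \<in> borel_measurable (tau_algebra MT \<tau> (Suc n))" "\<And>\<omega>'. \<sigma> \<omega>' \<in> {0..1}"
  shows "(\<lambda>(\<omega>, \<omega>'). beta mu phi W j (grid_time k n + \<sigma> \<omega>' * k) \<omega> - beta mu phi W j (grid_time k n) \<omega>)
    \<in> Lp_functions P (F (Suc n)) p"
proof -
  let ?s = "grid_time k n"
  define D where "D t \<omega> = (W (?s + t * k) \<omega> - W ?s \<omega>) \<bullet> phi j" for t \<omega>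
  note Suc_in = grid_time_in[of "Suc n"] and n_in = grid_time_in[of n]
  obtain m where "p \<le> real m"
    using real_arch_simple by blast
  then have m: "p \<le> real (2 * m)"
    by simp
  have "(\<lambda>(\<omega>, \<omega>'). D (\<sigma> \<omega>') \<omega>) \<in> Lp_functions P (F (Suc n)) p"
    unfolding grid_algebra_def
  proof (rule Lp_functions_random_time[OF MW MT _ _ subalgebra_tau _ _ \<sigma>])
    show "subalgebra MW (FW (grid_time k (Suc n)))" "null_sets MW \<subseteq> sets (FW (grid_time k (Suc n)))"
      using Suc_in n by (auto intro!: subalgebra_FW null_sets_FW)
  next
    fix t :: real assume t: "t \<in> {0..1}"
    have W: "W u \<in> borel_measurable (FW (grid_time k (Suc n)))" if "u \<in> {?s..grid_time k (Suc n)}" for u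
    proof (rule measurable_from_subalg)
      show "subalgebra (FW (grid_time k (Suc n))) (FW u)"
        using that n_in Suc_in n by (intro subalgebra_FW_mono) auto
      show "W u \<in> borel_measurable (FW u)"
        using Wiener that n_in Suc_in n by (auto simp: Q_Wiener_process_def)
    qed
    have [measurable]: "W (?s + t * k) \<in> borel_measurable (FW (grid_time k (Suc n)))"
      "W ?s \<in> borel_measurable (FW (grid_time k (Suc n)))"
      using W intermediate_time_in[OF n t] intermediate_time_in[OF n, of 0] by auto
    show "D t \<in> borel_measurable (FW (grid_time k (Suc n)))"
      unfolding D_def by measurable
    have st: "?s \<in> {0..T}" "?s + t * k \<in> {?s..T}"
      using intermediate_time_in[OF n t] n_in n by auto
    then have "normal_rv MW 0 ((?s + t * k - ?s) * (Q (phi j) \<bullet> phi j)) (D t)"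
      using Wiener unfolding Q_Wiener_process_def D_def by blast
    then have normal: "normal_rv MW 0 (t * k * mu j) (D t)"
      by (simp add: Q_phi orthonormal_basis_inner[OF phi])
    have "t * k \<le> T"
      using st by auto
    then have "t * k * mu j \<le> T * mu j"
      using mu by (rule mult_right_mono)
    then show "(\<integral>\<^sup>+\<omega>. ennreal (norm (D t \<omega>) powr p) \<partial>MW)
        \<le> ennreal (1 + fact (2 * m) / ((2 / (T * mu j)) ^ m * fact m))"
      using t k mu[of j] p m by (intro normal_moment_bound[OF MW normal]) simp_all
  next
    have "AE \<omega> in MW. continuous_on {0..T} (\<lambda>t. W t \<omega>)"
      using Wiener by (simp add: Q_Wiener_process_def)
    then show "AE \<omega> in MW. continuous_on {0..1} (\<lambda>t. D t \<omega>)"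
    proof eventually_elim
      case (elim \<omega>)
      have "continuous_on {0..1} (\<lambda>t. W (?s + t * k) \<omega>)"
        using intermediate_time_in(2)[OF n]
        by (intro continuous_on_compose2[OF elim]) (auto intro!: continuous_intros)
      then show ?case
        unfolding D_def by (intro continuous_intros)
    qed
  qed
  from Lp_scaleR(1)[OF p_ge_1 subalgebra_F this, of "1 / sqrt (mu j)"] n
  show ?thesis
    by (simp add: D_def beta_def case_prod_beta' inner_diff_left diff_divide_distrib)
qed

text \<open>
  The truncated noise has finitely many coordinates, so the diffusion term is a finite sum of
  coordinates of the noise with continuous and bounded coefficients.
\<close>

lemma noise_term_Lp:
  assumes n: "n < N" and \<sigma>: "\<sigma> \<in> borel_measurable (tau_algebra MT \<tau> (Suc n))" "\<And>\<omega>'. \<sigma> \<omega>' \<in> {0..1}"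
    and \<rho>: "\<rho> \<in> borel_measurable (tau_algebra MT \<tau> (Suc n))" "\<And>\<omega>'. \<rho> \<omega>' \<in> {0..1}"
  shows "(\<lambda>(\<omega>, \<omega>'). g (grid_time k n + \<rho> \<omega>' * k)
      (noise_increment mu phi W M (\<sigma> \<omega>' * k) (grid_time k n) \<omega>)) \<in> Lp_functions P (F (Suc n)) p"
proof -
  let ?s = "grid_time k n"
  let ?G = "\<lambda>j t. g (?s + t * k) (op_pow mu phi (1/2) (phi j))"
  have F: "subalgebra P (F (Suc n))"
    using n by (intro subalgebra_F) simp
  have \<rho>': "(\<lambda>z. \<rho> (snd z)) \<in> borel_measurable (F (Suc n))"
    unfolding grid_algebra_def by (rule measurable_compose[OF measurable_snd \<rho>(1)])
  have L20: "g t \<in> L20 mu phi" if "t \<in> {0..T}" for t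
    using g_continuous that by (simp add: L20_continuous_def)
  have term_Lp: "(\<lambda>z. (beta mu phi W j (?s + \<sigma> (snd z) * k) (fst z) - beta mu phi W j ?s (fst z)) *\<^sub>R ?G j (\<rho> (snd z)))
      \<in> Lp_functions P (F (Suc n)) p" for j
  proof (rule Lp_functions_compose[where G = "\<lambda>t x. x *\<^sub>R ?G j t" and I = "{0..1}" and a = 0 and b = Cg,
        OF p_ge_1 P F beta_increment_Lp[OF n \<sigma>, of j, unfolded case_prod_beta'] \<rho>'])
    have "continuous_on {0..1} (?G j)"
      using intermediate_time_in(2)[OF n]
      by (intro continuous_on_compose2[OF continuous_on_L20_apply[OF g_continuous]]) (auto intro!: continuous_intros)
    then have "continuous_on ({0..1} \<times> (UNIV :: real set)) (\<lambda>z. ?G j (fst z))"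
      by (rule continuous_on_compose2) (auto intro!: continuous_intros)
    then show "continuous_on ({0..1} \<times> UNIV) (\<lambda>(t, x). x *\<^sub>R ?G j t)"
      unfolding case_prod_beta' by (intro continuous_intros)
    show "norm (x *\<^sub>R ?G j t) \<le> 0 + Cg * norm x" if "t \<in> {0..1}" for t x
    proof -
      have "norm (?G j t) \<le> Cg"
        using norm_L20_le[OF L20] g_bounded intermediate_time_in(2)[OF n that] order_trans by blast
      then show ?thesis
        by (simp add: mult.commute[of Cg] mult_left_mono)
    qed
  qed (rule \<rho>(2))
  have "(\<lambda>z. \<Sum>j<M. (beta mu phi W j (?s + \<sigma> (snd z) * k) (fst z) - beta mu phi W j ?s (fst z)) *\<^sub>R ?G j (\<rho> (snd z)))
      \<in> Lp_functions P (F (Suc n)) p"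
    by (rule Lp_sum[OF p_ge_1 F term_Lp, THEN conjunct1])
  moreover have "g (?s + \<rho> \<omega>' * k) (noise_increment mu phi W M (\<sigma> \<omega>' * k) ?s \<omega>) =
      (\<Sum>j<M. (beta mu phi W j (?s + \<sigma> \<omega>' * k) \<omega> - beta mu phi W j ?s \<omega>) *\<^sub>R ?G j (\<rho> \<omega>'))" for \<omega> \<omega>'
    by (rule L20_noise_increment[OF L20[OF intermediate_time_in(2)[OF n \<rho>(2)]] phi mu])
  ultimately show ?thesis
    by (simp add: case_prod_beta')
qed

subsection \<open>One step of the scheme\<close>

lemma continuous_on_f:
  assumes "n < N"
  shows "continuous_on ({0..1} \<times> UNIV) (\<lambda>(t, x). f (grid_time k n + t * k) x)"
proof -
  have "continuous_on ({0..1} \<times> UNIV) (\<lambda>z. (\<lambda>(t, x). f t x) (grid_time k n + fst z * k, snd z :: 'h))"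
    using intermediate_time_in(2)[OF assms]
    by (intro continuous_on_compose2[OF f_continuous]) (auto intro!: continuous_intros)
  then show ?thesis
    by (simp add: case_prod_beta')
qed

lemma continuous_on_S: "continuous_on ({0..1} \<times> UNIV) (\<lambda>(t, x). S (t * k) x)"
proof -
  have "continuous_on ({0..1} \<times> UNIV) (\<lambda>z. (\<lambda>(\<theta>, x). S \<theta> x) (fst z * k, snd z :: 'h))"
    using k by (intro continuous_on_compose2[OF continuous_on_S_op]) (auto intro!: continuous_intros)
  then show ?thesis
    by (simp add: case_prod_beta')
qed

text \<open>
  One step consists of the explicit predictor at the random time, the resolvent, the drift at the
  random time, the second resolvent and the noise; each of them preserves adaptedness and finite
  \<open>p\<close>-th moments.
\<close>

lemma increment_Lp:
  assumes n: "n < N" and X: "X \<in> Lp_functions P (F n) p"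
  shows "(\<lambda>z. \<Phi> (Suc n) (X z) z) \<in> Lp_functions P (F (Suc n)) p"
proof -
  let ?s = "grid_time k n" and ?\<theta> = "\<lambda>z::'w \<times> 't. \<theta> (Suc n) (snd z)"
  obtain K where K: "\<And>t u. t \<in> {0..T} \<Longrightarrow> norm (f t u) \<le> K + Cf * norm u"
    using f_growth by blast
  have F: "subalgebra P (F (Suc n))"
    using n by (intro subalgebra_F) simp
  have \<theta>_tau: "\<theta> (Suc n) \<in> borel_measurable (tau_algebra MT \<tau> (Suc n))"
    by (rule \<theta>_measurable) simp
  have \<theta>': "?\<theta> \<in> borel_measurable (F (Suc n))"
    unfolding grid_algebra_def by (rule measurable_compose[OF measurable_snd \<theta>_tau])
  have s: "?s \<in> {0..T}"
    using grid_time_in[of n] n by simp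
  note compose = Lp_functions_compose[OF p_ge_1 P F _ \<theta>' \<theta>_in]
  have X': "X \<in> Lp_functions P (F (Suc n)) p"
    using Lp_functions_mono[OF subalgebra_F_Suc[OF n]] X by blast
  have "(\<lambda>z. X z - (?\<theta> z * k) *\<^sub>R f ?s (X z)) \<in> Lp_functions P (F (Suc n)) p"
  proof (rule compose[OF X', where G = "\<lambda>t x. x - (t * k) *\<^sub>R f ?s x" and a = "k * \<bar>K\<bar>" and b = "1 + k * Cf"])
    have "continuous_on ({0..1} \<times> UNIV) (\<lambda>z. (\<lambda>(t, u). f t u) (?s, snd z))"
      using s by (intro continuous_on_compose2[OF f_continuous]) (auto intro!: continuous_intros)
    then show "continuous_on ({0..1} \<times> UNIV) (\<lambda>(t, x). x - (t * k) *\<^sub>R f ?s x)"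
      unfolding case_prod_beta' by (auto intro!: continuous_intros)
    fix t x assume t: "t \<in> {0..1::real}"
    have "norm (x - (t * k) *\<^sub>R f ?s x) \<le> norm x + t * k * norm (f ?s x)"
      using norm_triangle_ineq4[of x "(t * k) *\<^sub>R f ?s x"] t k by simp
    also have "\<dots> \<le> norm x + k * (\<bar>K\<bar> + Cf * norm x)"
      using t k K[OF s, of x] by (intro add_left_mono mult_mono) (auto intro: mult_left_le_one_le)
    finally show "norm (x - (t * k) *\<^sub>R f ?s x) \<le> k * \<bar>K\<bar> + (1 + k * Cf) * norm x"
      by (simp add: algebra_simps)
  qed
  moreover have "(\<lambda>z. g ?s (noise_increment mu phi W M (?\<theta> z * k) ?s (fst z))) \<in> Lp_functions P (F (Suc n)) p"
    using noise_term_Lp[OF n \<theta>_tau \<theta>_in, of "\<lambda>_. 0"] by (simp add: case_prod_beta')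
  ultimately have "(\<lambda>z. X z - (?\<theta> z * k) *\<^sub>R f ?s (X z) + g ?s (noise_increment mu phi W M (?\<theta> z * k) ?s (fst z)))
      \<in> Lp_functions P (F (Suc n)) p"
    by (rule Lp_add(1)[OF p_ge_1 F])
  then have "(\<lambda>z. Psi lam e mu phi f g W Vh k M (Suc n) (X z) (?\<theta> z) (fst z)) \<in> Lp_functions P (F (Suc n)) p"
    unfolding Psi_def Let_def diff_Suc_1
    using k norm_S_op_le
    by (intro compose[where G = "\<lambda>t x. S (t * k) x" and a = 0 and b = 1] continuous_on_S) auto
  then have "(\<lambda>z. f (?s + ?\<theta> z * k) (Psi lam e mu phi f g W Vh k M (Suc n) (X z) (?\<theta> z) (fst z)))
      \<in> Lp_functions P (F (Suc n)) p"
    using K intermediate_time_in(2)[OF n]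
    by (intro compose[where G = "\<lambda>t x. f (?s + t * k) x" and a = K and b = Cf] continuous_on_f n) auto
  then have "(\<lambda>z. S (1 * k) (f (?s + ?\<theta> z * k) (Psi lam e mu phi f g W Vh k M (Suc n) (X z) (?\<theta> z) (fst z))))
      \<in> Lp_functions P (F (Suc n)) p"
    using k norm_S_op_le
    by (intro Lp_functions_compose[where G = "\<lambda>t x. S (t * k) x" and \<theta> = "\<lambda>_. 1" and I = "{0..1}" and a = 0 and b = 1,
          OF p_ge_1 P F] continuous_on_S) auto
  then have 1: "(\<lambda>z. (- k) *\<^sub>R S k (f (?s + ?\<theta> z * k) (Psi lam e mu phi f g W Vh k M (Suc n) (X z) (?\<theta> z) (fst z))))
      \<in> Lp_functions P (F (Suc n)) p"
    unfolding mult_1 by (rule Lp_scaleR(1)[OF p_ge_1 F])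
  have "(\<lambda>z. g (?s + ?\<theta> z * k) (noise_increment mu phi W M k ?s (fst z))) \<in> Lp_functions P (F (Suc n)) p"
    using noise_term_Lp[OF n _ _ \<theta>_tau \<theta>_in, of "\<lambda>_. 1"] by (simp add: case_prod_beta')
  then have 2: "(\<lambda>z. S (1 * k) (g (?s + ?\<theta> z * k) (noise_increment mu phi W M k ?s (fst z)))) \<in> Lp_functions P (F (Suc n)) p"
    using k norm_S_op_le
    by (intro Lp_functions_compose[where G = "\<lambda>t x. S (t * k) x" and \<theta> = "\<lambda>_. 1" and I = "{0..1}" and a = 0 and b = 1,
          OF p_ge_1 P F] continuous_on_S) auto
  have "(\<lambda>z. Phi lam e mu phi f g W Vh k M (Suc n) (X z) (?\<theta> z) (fst z)) \<in> Lp_functions P (F (Suc n)) p"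
    using Lp_add(1)[OF p_ge_1 F 1 2] by (simp add: Phi_def Let_def)
  then show ?thesis
    by (rule Lp_functions_cong_AE) (use AE_\<theta>[of "Suc n"] in \<open>auto simp: \<Phi>_def case_prod_beta' elim!: eventually_mono\<close>)
qed

text \<open>
  The noise is additive and cancels in differences of two steps, so that the increment is
  Lipschitz continuous for every realization of the noise.
\<close>

lemma Phi_lipschitz:
  assumes n: "n < N" and t: "t \<in> {0..1}"
  shows "norm (Phi lam e mu phi f g W Vh k M (Suc n) x t \<omega> - Phi lam e mu phi f g W Vh k M (Suc n) y t \<omega>)
    \<le> k * (Cf * (1 + T * Cf)) * norm (x - y)"
proof -
  let ?s = "grid_time k n"
  let ?\<Psi> = "\<lambda>x. Psi lam e mu phi f g W Vh k M (Suc n) x t \<omega>"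
  have "t * k \<le> 1 * k"
    using t k by (intro mult_right_mono) auto
  then have tk: "0 \<le> t * k" "t * k \<le> T"
    using t k by (simp, linarith)
  have s: "?s \<in> {0..T}"
    using grid_time_in[of n] n by simp
  have "?\<Psi> x - ?\<Psi> y = S (t * k) ((x - y) - (t * k) *\<^sub>R (f ?s x - f ?s y))"
    unfolding Psi_def Let_def diff_Suc_1 linear_diff[OF linear_S_op[OF tk(1)], symmetric]
    by (simp add: algebra_simps)
  then have "norm (?\<Psi> x - ?\<Psi> y) \<le> norm ((x - y) - (t * k) *\<^sub>R (f ?s x - f ?s y))"
    using norm_S_op_le[OF tk(1)] by simp
  also have "\<dots> \<le> norm (x - y) + t * k * norm (f ?s x - f ?s y)"
    using norm_triangle_ineq4[of "x - y" "(t * k) *\<^sub>R (f ?s x - f ?s y)"] tk by simp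
  also have "\<dots> \<le> norm (x - y) + T * (Cf * norm (x - y))"
    using f_lipschitz[OF s] tk by (intro add_left_mono mult_mono) auto
  finally have \<Psi>: "norm (?\<Psi> x - ?\<Psi> y) \<le> (1 + T * Cf) * norm (x - y)"
    by (simp add: algebra_simps)
  have "Phi lam e mu phi f g W Vh k M (Suc n) x t \<omega> - Phi lam e mu phi f g W Vh k M (Suc n) y t \<omega>
      = - (k *\<^sub>R S k (f (?s + t * k) (?\<Psi> x) - f (?s + t * k) (?\<Psi> y)))"
    using k by (simp add: Phi_def Let_def linear_diff[OF linear_S_op] scaleR_diff_right)
  then have "norm (Phi lam e mu phi f g W Vh k M (Suc n) x t \<omega> - Phi lam e mu phi f g W Vh k M (Suc n) y t \<omega>)
      \<le> k * norm (f (?s + t * k) (?\<Psi> x) - f (?s + t * k) (?\<Psi> y))"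
    using norm_S_op_le[of k] k by simp
  also have "\<dots> \<le> k * (Cf * ((1 + T * Cf) * norm (x - y)))"
    using f_lipschitz[OF intermediate_time_in(2)[OF n t], of "?\<Psi> x" "?\<Psi> y"] \<Psi> k Cf
    by (intro mult_left_mono) (auto intro: order_trans mult_left_mono)
  finally show ?thesis
    by (simp add: mult.assoc)
qed

lemma increment_lipschitz:
  assumes "n < N"
  shows "AE z in P. \<forall>x y. norm (\<Phi> (Suc n) x z - \<Phi> (Suc n) y z) \<le> k * (Cf * (1 + T * Cf)) * norm (x - y)"
proof -
  have "AE \<omega>' in MT. \<tau> (Suc n) \<omega>' \<in> {0..1}"
    by (rule \<tau>_range) simp
  from AE_pair_sndI[OF MW MT this] show ?thesis
  proof eventually_elim
    case (elim z)
    then show ?case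
      using Phi_lipschitz[OF assms, of "\<tau> (Suc n) (snd z)"] by (simp add: \<Phi>_def case_prod_beta)
  qed
qed

text \<open>
  The initial value is a constant process, so evaluating it at a dummy random time transfers its
  integrability to the product space.
\<close>

lemma initial_Lp: "(\<lambda>(\<omega>, \<omega>'). orth_proj Vh (X0 \<omega>)) \<in> Lp_functions P (F 0) p"
proof -
  have p0: "0 < p" using p by simp
  have F0: "subalgebra MW (FW 0)"
    using subalgebra_FW[of 0] T_pos by simp
  have "(\<lambda>\<omega>. dotH_norm lam e r (X0 \<omega>)) \<in> borel_measurable (FW 0)"
    using X0(1) unfolding dotH_norm_def op_pow_def by measurable
  then have "(\<lambda>\<omega>. dotH_norm lam e r (X0 \<omega>)) \<in> Lp_functions MW (FW 0) p"
    using X0(3) by (auto simp: Lp_functions_def dotH_norm_def)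
  note scaled = Lp_scaleR(1)[OF p_ge_1 F0 this, of "lam 0 powr (- r / 2)"]
  have X0_Lp: "X0 \<in> Lp_functions MW (FW 0) p"
  proof (rule Lp_functions_dominated[OF p0 scaled])
    show "AE \<omega> in MW. norm (X0 \<omega>) \<le> norm (lam 0 powr (- r / 2) *\<^sub>R dotH_norm lam e r (X0 \<omega>))"
      using X0(2) by eventually_elim (use norm_le_dotH_norm[OF e lam r] in \<open>auto simp: abs_mult dotH_norm_def\<close>)
  qed (use X0(1) in auto)
  have "(\<lambda>(\<omega>, \<omega>'). X0 \<omega>) \<in> Lp_functions P (F 0) p"
    unfolding grid_algebra_def grid_time_0
  proof (rule Lp_functions_random_time[where D = "\<lambda>_. X0" and \<theta> = "\<lambda>_. 0", OF MW MT F0 _ subalgebra_tau X0(1)])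
    show "null_sets MW \<subseteq> sets (FW 0)"
      using null_sets_FW[of 0] T_pos by simp
    show "(\<integral>\<^sup>+\<omega>. ennreal (norm (X0 \<omega>) powr p) \<partial>MW) \<le> ennreal (Lp_norm MW p X0 powr p)"
      using nn_integral_norm_powr_eq_Lp_norm[OF p0 X0_Lp] by simp
  qed auto
  then have "(\<lambda>z. X0 (fst z)) \<in> Lp_functions P (F 0) p"
    by (simp add: case_prod_beta')
  moreover have "continuous_on UNIV (orth_proj Vh)"
    using linear_orth_proj norm_orth_proj_le
    by (intro linear_continuous_on bounded_linear_intro[where K = 1]) (auto simp: linear_add linear_scale)
  ultimately have "(\<lambda>z. orth_proj Vh (X0 (fst z))) \<in> Lp_functions P (F 0) p"
    using Lp_functions_lipschitz_image[OF p0] norm_orth_proj_le by blast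
  then show ?thesis
    by (simp add: case_prod_beta')
qed

sublocale one_step_method P F p "k * (Cf * (1 + T * Cf))" N "S k" \<Phi> "\<lambda>(\<omega>, \<omega>'). orth_proj Vh (X0 \<omega>)"
proof (rule one_step_method.intro)
  show "1 \<le> N"
    using num_steps_bounds(3)[OF k] .
  show "0 \<le> k * (Cf * (1 + T * Cf))"
    using k Cf T_pos by simp
qed (use k in \<open>auto intro: p_ge_1 subalgebra_F subalgebra_F_Suc linear_S_op norm_S_op_le initial_Lp
  increment_Lp increment_lipschitz\<close>)

lemma residual_eq_res: "residual lam e mu phi f g W X0 \<tau> Vh k M = res"
  by (intro ext) (auto simp: residual_def res_def \<Phi>_def)

lemma grid_functions_eq: "grid_functions MW FW MT \<tau> T p k = grid_space"
  by (simp add: grid_functions_def grid_space_def)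

lemma grid_ae_eq_eq: "grid_ae_eq MW FW MT \<tau> T p k = grid_eq"
  by (simp add: grid_ae_eq_def grid_eq_def grid_functions_eq)

lemma grid_norm_inf_eq: "grid_norm_inf P T p k = norm_inf"
  by (intro ext) (simp add: grid_norm_inf_def norm_inf_def)

lemma grid_norm_S_eq: "grid_norm_S P lam e Vh T p k = norm_S"
  by (intro ext) (simp add: grid_norm_S_def norm_S_def)

lemmas scheme_eqs = residual_eq_res grid_functions_eq grid_ae_eq_eq grid_norm_inf_eq grid_norm_S_eq

lemma N_increment_le: "real N * (k * (Cf * (1 + T * Cf))) \<le> T * (Cf * (1 + T * Cf))"
proof -
  have "real N * k * (Cf * (1 + T * Cf)) \<le> T * (Cf * (1 + T * Cf))"
    using num_steps_bounds(1)[OF k] Cf T_pos by (intro mult_right_mono) auto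
  then show ?thesis
    by (simp add: mult.assoc)
qed

lemma norm_inf_nonneg: "0 \<le> norm_inf Z"
  using Lp_norm_le_norm_inf[of 0 Z] Lp_norm_nonneg[of P p "Z 0"] by linarith

lemma norm_S_nonneg: "0 \<le> norm_S Z"
proof -
  have "0 \<le> (MAX n\<in>{1..N}. Lp_norm P p (\<lambda>\<omega>. \<Sum>j=1..n. (S k ^^ (n - j)) (Z j \<omega>)))"
    using N by (subst Max_ge_iff) (auto simp: Lp_norm_nonneg intro!: bexI[of _ 1])
  then show ?thesis
    unfolding norm_S_def using Lp_norm_nonneg[of P p "Z 0"] by simp
qed

text \<open>
  One constant that dominates both \<open>3 + L\<close>, from solving for the residuals, and \<open>exp L\<close>, from
  Gronwall's inequality. The step size disappears because of \<open>N * k \<le> T\<close>.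
\<close>

lemma bistable:
  assumes Y: "Y \<in> grid_space" and Z: "Z \<in> grid_space" and L: "L = T * (Cf * (1 + T * Cf))"
  shows "1 / (3 + L + exp L) * norm_S (res Y - res Z) \<le> norm_inf (Y - Z)"
    and "norm_inf (Y - Z) \<le> (3 + L + exp L) * norm_S (res Y - res Z)"
proof -
  let ?\<kappa> = "real N * (k * (Cf * (1 + T * Cf)))"
  have L0: "0 \<le> L" and \<kappa>: "?\<kappa> \<le> L"
    using T_pos Cf N_increment_le by (auto simp: L)
  have "norm_S (res Y - res Z) \<le> (3 + ?\<kappa>) * norm_inf (Y - Z)"
    by (rule norm_S_le_norm_inf[OF Y Z])
  also have "\<dots> \<le> (3 + L + exp L) * norm_inf (Y - Z)"
    using \<kappa> norm_inf_nonneg exp_ge_zero[of L] by (intro mult_right_mono) linarith+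
  finally show "1 / (3 + L + exp L) * norm_S (res Y - res Z) \<le> norm_inf (Y - Z)"
    using L0 exp_gt_zero[of L] by (simp add: divide_le_eq mult.commute add_pos_pos)
  have "norm_inf (Y - Z) \<le> exp ?\<kappa> * norm_S (res Y - res Z)"
    by (rule norm_inf_le_norm_S[OF Y Z])
  also have "\<dots> \<le> (3 + L + exp L) * norm_S (res Y - res Z)"
  proof (rule mult_right_mono[OF _ norm_S_nonneg])
    show "exp ?\<kappa> \<le> 3 + L + exp L"
      using L0 \<kappa> exp_le_cancel_iff[of ?\<kappa> L] by linarith
  qed
  finally show "norm_inf (Y - Z) \<le> (3 + L + exp L) * norm_S (res Y - res Z)" .
qed

end

section \<open>Bistability of the randomized scheme with truncated noise\<close>

theorem theorem6p2:
  fixes MW :: "'w measure" and FW :: "real \<Rightarrow> 'w measure"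
    and MT :: "'t measure" and \<tau> :: "nat \<Rightarrow> 't \<Rightarrow> real"
    and W :: "real \<Rightarrow> 'w \<Rightarrow> 'u::{real_inner,banach,second_countable_topology}"
    and Q :: "'u \<Rightarrow> 'u" and mu :: "nat \<Rightarrow> real" and phi :: "nat \<Rightarrow> 'u"
    and domA :: "'h::{real_inner,banach,second_countable_topology} set" and A :: "'h \<Rightarrow> 'h"
    and lam :: "nat \<Rightarrow> real" and e :: "nat \<Rightarrow> 'h"
    and V :: "real \<Rightarrow> 'h set"
    and X0 :: "'w \<Rightarrow> 'h" and f :: "real \<Rightarrow> 'h \<Rightarrow> 'h" and g :: "real \<Rightarrow> 'u \<Rightarrow> 'h"
    and T p r \<gamma> Cf Cg :: real
  assumes T: "0 < T" and p: "2 \<le> p" and r: "0 \<le> r" "r \<le> 1" and \<gamma>: "0 < \<gamma>" "\<gamma> \<le> 1/2"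
    \<comment> \<open>filtered probability space, Wiener process, covariance operator\<close>
    and "usual_conditions MW T FW"
    and "Q_Wiener_process MW T FW Q W"
    and "bounded_linear Q" "\<forall>u v. Q u \<bullet> v = u \<bullet> Q v" "\<forall>u. 0 \<le> Q u \<bullet> u"
    and "orthonormal_basis phi" "\<forall>j. Q (phi j) = mu j *\<^sub>R phi j"
    and "summable (\<lambda>j. Q (phi j) \<bullet> phi j)"
    \<comment> \<open>the operator A and its eigenbasis\<close>
    and "linear_operator domA A" "closure domA = UNIV" "self_adjoint_operator domA A"
    and "\<forall>x\<in>domA. x \<noteq> 0 \<longrightarrow> 0 < A x \<bullet> x"
    and "has_compact_inverse domA A"
    and "orthonormal_basis e" "\<forall>j. e j \<in> domA \<and> A (e j) = lam j *\<^sub>R e j"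
    and "\<forall>j. 0 < lam j" "incseq lam" "filterlim lam at_top sequentially"
    \<comment> \<open>initial value\<close>
    and "X0 \<in> borel_measurable (FW 0)" "AE \<omega> in MW. X0 \<omega> \<in> dotH lam e (1 + r)"
    and "(\<integral>\<^sup>+\<omega>. ennreal (dotH_norm lam e (1 + r) (X0 \<omega>) powr p) \<partial>MW) < \<infinity>"
    \<comment> \<open>drift\<close>
    and "continuous_on ({0..T} \<times> UNIV) (\<lambda>(t, u). f t u)" and "0 < Cf"
    and "\<forall>t\<in>{0..T}. \<forall>u1 u2. norm (f t u1 - f t u2) \<le> Cf * norm (u1 - u2)"
    and "\<forall>t1\<in>{0..T}. \<forall>t2\<in>{0..T}. \<forall>u.
           norm (f t1 u - f t2 u) \<le> Cf * (1 + norm u) * \<bar>t1 - t2\<bar> powr \<gamma>"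
    \<comment> \<open>diffusion\<close>
    and "L20_continuous mu phi T g" and "0 < Cg"
    and "\<forall>t\<in>{0..T}. \<forall>u. g t (op_pow mu phi (1/2) u) \<in> dotH lam e r"
    and "L20_continuous mu phi T (\<lambda>t u. op_pow lam e (r / 2) (g t u))"
    and "hoelder_norm (L20_norm mu phi) T (1/2) g
         + sup_norm (L20_norm mu phi) T (\<lambda>t u. op_pow lam e (r / 2) (g t u))
         + L20_sobolev_norm mu phi T (1/2 + \<gamma>) p g \<le> ennreal Cg"
    \<comment> \<open>Galerkin spaces\<close>
    and "\<forall>h\<in>{0<..<1}. subspace (V h) \<and> V h \<subseteq> dotH lam e 1 \<and> (\<exists>B. finite B \<and> V h = span B)"
    \<comment> \<open>randomization\<close>
    and "prob_space MT" "prob_space.indep_vars MT (\<lambda>_. borel) \<tau> {1..}"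
    and "\<forall>n\<ge>1. distr MT borel (\<tau> n) = uniform_measure lborel {0<..<1}"
  shows "(\<forall>k\<in>{0<..<T}. \<forall>h\<in>{0<..<1}. \<forall>M\<ge>1.
            let G = grid_functions MW FW MT \<tau> T p k;
                E = grid_ae_eq MW FW MT \<tau> T p k;
                R = residual lam e mu phi f g W X0 \<tau> (V h) k M
            in R \<in> G \<rightarrow> G \<and> (\<lambda>Z. E `` {R Z}) respects E \<and>
               bij_betw (\<lambda>c. \<Union>Z\<in>c. E `` {R Z}) (G // E) (G // E)) \<and>
         (\<exists>C>0. \<forall>k\<in>{0<..<T}. \<forall>h\<in>{0<..<1}. \<forall>M\<ge>1.
            let G = grid_functions MW FW MT \<tau> T p k;
                R = residual lam e mu phi f g W X0 \<tau> (V h) k M;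
                norm_inf = grid_norm_inf (MW \<Otimes>\<^sub>M MT) T p k;
                norm_S = grid_norm_S (MW \<Otimes>\<^sub>M MT) lam e (V h) T p k
            in \<forall>Y\<in>G. \<forall>Z\<in>G.
                 1 / C * norm_S (R Y - R Z) \<le> norm_inf (Y - Z) \<and>
                 norm_inf (Y - Z) \<le> C * norm_S (R Y - R Z))"
proof -
  let ?L = "T * (Cf * (1 + T * Cf))"
  have phi: "orthonormal_basis phi"
    by fact
  have mu: "0 \<le> mu j" for j
    using \<open>\<forall>u. 0 \<le> Q u \<bullet> u\<close>[rule_format, of "phi j"] \<open>\<forall>j. Q (phi j) = mu j *\<^sub>R phi j\<close>
    by (simp add: orthonormal_basis_inner[OF phi])
  have g_bounded: "L20_norm mu phi (g t) \<le> Cg" if "t \<in> {0..T}" for t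
  proof -
    have "ennreal (L20_norm mu phi (g t)) \<le> sup_norm (L20_norm mu phi) T g"
      unfolding sup_norm_def using that by (rule SUP_upper)
    also have "\<dots> \<le> hoelder_norm (L20_norm mu phi) T (1/2) g"
      unfolding hoelder_norm_def by (rule add_increasing2) auto
    also have "\<dots> \<le> hoelder_norm (L20_norm mu phi) T (1/2) g
         + sup_norm (L20_norm mu phi) T (\<lambda>t u. op_pow lam e (r / 2) (g t u))
         + L20_sobolev_norm mu phi T (1/2 + \<gamma>) p g"
      unfolding add.assoc by (rule add_increasing2) auto
    also have "\<dots> \<le> ennreal Cg"
      by fact
    finally show ?thesis
      using \<open>0 < Cg\<close> by simp
  qed
  have \<tau>_measurable: "\<tau> n \<in> borel_measurable MT" if "1 \<le> n" for n
    using \<open>prob_space.indep_vars MT (\<lambda>_. borel) \<tau> {1..}\<close> \<open>prob_space MT\<close> that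
    by (simp add: prob_space.indep_vars_def)
  have \<tau>_range: "AE \<omega> in MT. \<tau> n \<omega> \<in> {0..1}" if n: "1 \<le> n" for n
  proof -
    have "AE t in uniform_measure lborel {0<..<1::real}. t \<in> {0..1}"
      by (intro AE_uniform_measureI AE_I2) auto
    moreover have "distr MT borel (\<tau> n) = uniform_measure lborel {0<..<1}"
      using \<open>\<forall>n\<ge>1. distr MT borel (\<tau> n) = uniform_measure lborel {0<..<1}\<close> n by blast
    ultimately have "AE t in distr MT borel (\<tau> n). t \<in> {0..1}"
      by (simp only:)
    then show ?thesis
      by (rule AE_distrD[OF \<tau>_measurable[OF n]])
  qed
  have galerkin: "randomized_galerkin lam e (V h) MW FW MT \<tau> W Q mu phi f g X0 T p (1 + r) Cf Cg k"
    if k: "k \<in> {0<..<T}" and h: "h \<in> {0<..<1}" for k h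
  proof (intro randomized_galerkin.intro galerkin_space.intro randomized_galerkin_axioms.intro)
    show "subspace (V h)" "V h \<subseteq> dotH lam e 1" "\<exists>B. finite B \<and> V h = span B"
      using \<open>\<forall>h\<in>{0<..<1}. subspace (V h) \<and> V h \<subseteq> dotH lam e 1 \<and> (\<exists>B. finite B \<and> V h = span B)\<close> h by auto
    show "0 < k" "k < T" "0 \<le> 1 + r"
      using k r by auto
    show "Q (phi j) = mu j *\<^sub>R phi j" "0 < lam j" for j
      using \<open>\<forall>j. Q (phi j) = mu j *\<^sub>R phi j\<close> \<open>\<forall>j. 0 < lam j\<close> by auto
    show "norm (f t u1 - f t u2) \<le> Cf * norm (u1 - u2)" if "t \<in> {0..T}" for t u1 u2
      using \<open>\<forall>t\<in>{0..T}. \<forall>u1 u2. norm (f t u1 - f t u2) \<le> Cf * norm (u1 - u2)\<close> that by blast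
  qed (fact mu g_bounded \<tau>_measurable \<tau>_range | fact)+
  show ?thesis
  proof (intro conjI exI[of _ "3 + ?L + exp ?L"] ballI allI impI)
    show "0 < 3 + ?L + exp ?L"
      using T \<open>0 < Cf\<close> by (intro add_pos_pos add_pos_nonneg) auto
  next
    fix k h :: real and M :: nat assume "k \<in> {0<..<T}" "h \<in> {0<..<1}"
    then interpret randomized_galerkin lam e "V h" MW FW MT \<tau> W Q mu phi f g X0 T p "1 + r" Cf Cg k M
      by (rule galerkin)
    show "let G = grid_functions MW FW MT \<tau> T p k;
                E = grid_ae_eq MW FW MT \<tau> T p k;
                R = residual lam e mu phi f g W X0 \<tau> (V h) k M
            in R \<in> G \<rightarrow> G \<and> (\<lambda>Z. E `` {R Z}) respects E \<and>
               bij_betw (\<lambda>c. \<Union>Z\<in>c. E `` {R Z}) (G // E) (G // E)"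
      unfolding scheme_eqs Let_def using res_in_grid_space bijective by blast
    show "let G = grid_functions MW FW MT \<tau> T p k;
                R = residual lam e mu phi f g W X0 \<tau> (V h) k M;
                norm_inf = grid_norm_inf (MW \<Otimes>\<^sub>M MT) T p k;
                norm_S = grid_norm_S (MW \<Otimes>\<^sub>M MT) lam e (V h) T p k
            in \<forall>Y\<in>G. \<forall>Z\<in>G.
                 1 / (3 + ?L + exp ?L) * norm_S (R Y - R Z) \<le> norm_inf (Y - Z) \<and>
                 norm_inf (Y - Z) \<le> (3 + ?L + exp ?L) * norm_S (R Y - R Z)"
      unfolding scheme_eqs Let_def using bistable[OF _ _ refl] by blast
  qed
qed

end
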